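(* Let $S$ be a near $e$ subsemigroup of a semitopological semigroup $(T,+)$, let $l\in\mathbb{N}$, and let $E^\Diamond\subseteq S^l$ be a near $\overline{e}$ subsemigroup of $T^l$ such that $\{\overline{a}:a\in S\}\subseteq E^\Diamond$. Let $I^\Diamond$ be an ideal of $E^\Diamond$ which is also a near $\overline{e}$ subsemigroup of $T^l$, such that for each $i\in\{1,\dots,l\}$ and each $\mathcal{E}_i\subseteq\pi_i[I^\Diamond]$, if $e\in cl_T(\mathcal{E}_i)$ then $\overline{e}\in cl_{T^l}(\pi_i^{-1}(\mathcal{E}_i))$, where $\pi_i:I^\Diamond\to\pi_i[I^\Diamond]$ is the projection onto the $i$-th coordinate. Let $B\subseteq S$. Then: (1) If $B\subseteq S$ is central near $e$, then $B^l\cap I^\Diamond\subseteq I^\Diamond$ is central near $\overline{e}$. (2) If $e$ has a countable local base in $T$ and $B\subseteq S$ is piecewise syndetic near $e$, then $B^l\cap I^\Diamond\subseteq I^\Diamond$ is piecewise syndetic near $\overline{e}$. (3) If $e$ has a countable local base in $T$ and $B\subseteq S$ is $central^*$ near $e$, then $B^l\cap I^\Diamond\subseteq I^\Diamond$ is $central^*$ near $\overline{e}$. (4) If $e$ has a countable local base in $T$ and $B\subseteq S$ is $PS^*$ near $e$, then $B^l\cap I^\Diamond\subseteq I^\Diamond$ is $PS^*$ near $\overline{e}$. (5) If $B\subseteq S$ is $IP^*$ near $e$, then $B^l\cap I^\Diamond\subseteq I^\Diamond$ is $IP^*$ near $\overline{e}$.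
   Context: A semitopological semigroup $(T,+)$ is a semigroup (written additively) with a Hausdorff topology in which all left and right translations are continuous; $E(T)$ is its set of idempotents and $\tau_x$ the set of neighborhoods of $x$. $T^l$ carries the product topology and coordinatewise operation; for $x$ in a set, $\overline{x}=(x,\dots,x)$ has all $l$ coordinates equal to $x$. A subsemigroup $S$ of $T$ with $e\in E(T)\setminus S$ is a near $e$ subsemigroup if $e\in cl_T(S)$. For a semigroup $S$, $\beta S$ is the set of ultrafilters on $S$ with $cl_{\beta S}A=\{p:A\in p\}$ and operation $p+q=\{A\subseteq S:\{s:-s+A\in q\}\in p\}$, $-s+A=\{t\in S:s+t\in A\}$. $e_S^*=\{p\in\beta S:U\cap S\in p\ \forall U\in\tau_e\}$ (a compact subsemigroup), $K(e_S^* )$ its smallest ideal. In a near $e$ subsemigroup $S$: $A\subseteq S$ is central near $e$ if $A\in p$ for some idempotent $p\in K(e_S^* )$; $central^*$ near $e$ if it meets every central set near $e$. For a sequence $\langle x_n\rangle$ in $S$ and $F=\{n_1<\dots<n_k\}$ finite nonempty, $\sum_{n\in F}x_n=x_{n_1}+\dots+x_{n_k}$ and $FS(\langle x_n\rangle_{n=m}^\infty)=\{\sum_{n\in F}x_n: F \text{ finite nonempty}, \min F\ge m\}$; $\sum x_n$ converges near $e$ if for each $U\in\tau_e$ there is $m$ with $FS(\langle x_n\rangle_{n=m}^\infty)\subseteq U$. $A$ is $IP$ near $e$ if $FS(\langle x_n\rangle_{n=1}^\infty)\subseteq A$ for some sequence in $S$ with $\sum x_n$ converging near $e$; $IP^*$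 near $e$ if it meets every $IP$ set near $e$. If $e$ has a countable decreasing local base $\langle W_n\rangle$, $A\subseteq S$ is piecewise syndetic near $e$ if there are finite nonempty $F_n\subseteq W_n\cap S$ and $V_n\in\tau_e$ with $V_n\subseteq W_n$ such that for every finite nonempty $G\subseteq S$ and $O\in\tau_e$ there is $x\in O\cap S$ with $(G\cap V_n)+x\subseteq\bigcup_{t\in F_n}(-t+A)$ for all $n$ (independent of the base); $A$ is $PS^*$ near $e$ if it meets every piecewise syndetic set near $e$. These notions are applied in $I^\Diamond$ as a near $\overline{e}$ subsemigroup of $T^l$. *)

theory Defs
  imports "HOL-Analysis.Analysis"
begin

section \<open>Semitopological semigroups\<close>

class semitopological_semigroup_add = semigroup_add + t2_space +
  assumes open_vimage_left_translation: "open U \<Longrightarrow> open ((\<lambda>x. a + x) -` U)"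
    and open_vimage_right_translation: "open U \<Longrightarrow> open ((\<lambda>x. x + a) -` U)"

lemma continuous_left_translation:
  "continuous_on UNIV (\<lambda>x. a + x)" for a :: "'a::semitopological_semigroup_add"
  by (simp add: continuous_on_open_vimage open_vimage_left_translation)

lemma continuous_right_translation:
  "continuous_on UNIV (\<lambda>x. x + a)" for a :: "'a::semitopological_semigroup_add"
  by (simp add: continuous_on_open_vimage open_vimage_right_translation)

text \<open>The power \<open>T\<^sup>l\<close> is the type \<^typ>\<open>'a ^ 'l\<close>, whose topology in the library is the
  product topology and whose addition is coordinatewise. The constant tuple with all
  coordinates equal to \<open>x\<close> is \<open>vec x\<close>.\<close>

instance vec :: (t0_space, finite) t0_space
proof
  fix x y :: "'a ^ 'b"
  assume "x \<noteq> y"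
  then obtain i where i: "x $ i \<noteq> y $ i"
    by (auto simp: vec_eq_iff)
  obtain U where "open U" "\<not> (x $ i \<in> U \<longleftrightarrow> y $ i \<in> U)"
    using t0_space_class.t0_space[OF i] by auto
  then show "\<exists>U. open U \<and> \<not> (x \<in> U \<longleftrightarrow> y \<in> U)"
    by (intro exI[of _ "(\<lambda>z. z $ i) -` U"]) (simp add: open_vimage_vec_nth)
qed

instance vec :: (t1_space, finite) t1_space
proof
  fix x y :: "'a ^ 'b"
  assume "x \<noteq> y"
  then obtain i where i: "x $ i \<noteq> y $ i"
    by (auto simp: vec_eq_iff)
  obtain U where "open U" "x $ i \<in> U" "y $ i \<notin> U"
    using t1_space_class.t1_space[OF i] by auto
  then show "\<exists>U. open U \<and> x \<in> U \<and> y \<notin> U"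
    by (intro exI[of _ "(\<lambda>z. z $ i) -` U"]) (simp add: open_vimage_vec_nth)
qed

instance vec :: (t2_space, finite) t2_space
proof
  fix x y :: "'a ^ 'b"
  assume "x \<noteq> y"
  then obtain i where i: "x $ i \<noteq> y $ i"
    by (auto simp: vec_eq_iff)
  obtain U V where UV: "open U" "open V" "x $ i \<in> U" "y $ i \<in> V" "U \<inter> V = {}"
    using hausdorff[OF i] by blast
  have "open ((\<lambda>z. z $ i) -` U)" "open ((\<lambda>z. z $ i) -` V)"
    using UV(1,2) by (auto intro: open_vimage_vec_nth)
  moreover have "((\<lambda>z. z $ i) -` U) \<inter> ((\<lambda>z. z $ i) -` V) = {}"
    using UV(5) by auto
  ultimately show "\<exists>U V. open U \<and> open V \<and> x \<in> U \<and> y \<in> V \<and> U \<inter> V = {}"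
    using UV(3,4) by (intro exI[of _ "(\<lambda>z. z $ i) -` U"] exI[of _ "(\<lambda>z. z $ i) -` V"]) simp
qed

instance vec :: (semitopological_semigroup_add, finite) semitopological_semigroup_add
proof
  fix a :: "'a ^ 'b"
  have L: "continuous_on UNIV (\<lambda>x :: 'a ^ 'b. a $ i + x $ i)" for i
    by (rule continuous_on_compose2[OF continuous_left_translation]) (auto intro: continuous_intros)
  have R: "continuous_on UNIV (\<lambda>x :: 'a ^ 'b. x $ i + a $ i)" for i
    by (rule continuous_on_compose2[OF continuous_right_translation]) (auto intro: continuous_intros)
  have "continuous_on UNIV (\<lambda>x. a + x)" "continuous_on UNIV (\<lambda>x. x + a)"
    unfolding plus_vec_def by (intro continuous_on_vec_lambda L R)+
  then show "open U \<Longrightarrow> open ((\<lambda>x. a + x) -` U)" "open U \<Longrightarrow> open ((\<lambda>x. x + a) -` U)" for U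
    by (simp_all add: continuous_on_open_vimage)
qed

definition neighborhoods :: "'a::topological_space \<Rightarrow> 'a set set" where
  "neighborhoods x = {U. x \<in> interior U}"

definition near_subsemigroup :: "'a::semitopological_semigroup_add \<Rightarrow> 'a set \<Rightarrow> bool" where
  "near_subsemigroup e S \<longleftrightarrow>
     S \<noteq> {} \<and> (\<forall>x\<in>S. \<forall>y\<in>S. x + y \<in> S) \<and> e + e = e \<and> e \<notin> S \<and> e \<in> closure S"

text \<open>Two-sided ideals are used both for subsemigroups of a type (with its addition) and for
  semigroups of ultrafilters, so the operation is a parameter.\<close>

definition semigroup_ideal :: "('b \<Rightarrow> 'b \<Rightarrow> 'b) \<Rightarrow> 'b set \<Rightarrow> 'b set \<Rightarrow> bool" where
  "semigroup_ideal f X J \<longleftrightarrow>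
     J \<noteq> {} \<and> J \<subseteq> X \<and> (\<forall>x\<in>X. \<forall>j\<in>J. f x j \<in> J \<and> f j x \<in> J)"

text \<open>When \<open>X\<close> has a smallest ideal, it is the intersection of all ideals of \<open>X\<close>.\<close>

definition smallest_ideal :: "('b \<Rightarrow> 'b \<Rightarrow> 'b) \<Rightarrow> 'b set \<Rightarrow> 'b set" where
  "smallest_ideal f X = \<Inter> {J. semigroup_ideal f X J}"

section \<open>Ultrafilters on a subsemigroup\<close>

definition beta :: "'a set \<Rightarrow> 'a set set set" where
  "beta S = {p. p \<subseteq> Pow S \<and> S \<in> p \<and> {} \<notin> p \<and>
       (\<forall>A\<in>p. \<forall>B\<in>p. A \<inter> B \<in> p) \<and>
       (\<forall>A\<in>p. \<forall>B. A \<subseteq> B \<and> B \<subseteq> S \<longrightarrow> B \<in> p) \<and>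
       (\<forall>A. A \<subseteq> S \<longrightarrow> A \<in> p \<or> S - A \<in> p)}"

text \<open>\<open>shift S s A\<close> is the set \<open>-s + A\<close>, formed inside \<open>S\<close>.\<close>

definition shift :: "'a::plus set \<Rightarrow> 'a \<Rightarrow> 'a set \<Rightarrow> 'a set" where
  "shift S s A = {t\<in>S. s + t \<in> A}"

definition beta_plus :: "'a::plus set \<Rightarrow> 'a set set \<Rightarrow> 'a set set \<Rightarrow> 'a set set" where
  "beta_plus S p q = {A. A \<subseteq> S \<and> {s\<in>S. shift S s A \<in> q} \<in> p}"

definition near_ultrafilters :: "'a::topological_space \<Rightarrow> 'a set \<Rightarrow> 'a set set set" where
  "near_ultrafilters e S = {p \<in> beta S. \<forall>U \<in> neighborhoods e. U \<inter> S \<in> p}"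

section \<open>Notions of largeness near an idempotent\<close>

definition star_family :: "('a set \<Rightarrow> bool) \<Rightarrow> 'a set \<Rightarrow> 'a set \<Rightarrow> bool" where
  "star_family P S A \<longleftrightarrow> A \<subseteq> S \<and> (\<forall>C. P C \<longrightarrow> A \<inter> C \<noteq> {})"

definition central_near :: "'a::semitopological_semigroup_add \<Rightarrow> 'a set \<Rightarrow> 'a set \<Rightarrow> bool" where
  "central_near e S A \<longleftrightarrow> A \<subseteq> S \<and>
     (\<exists>p \<in> smallest_ideal (beta_plus S) (near_ultrafilters e S). beta_plus S p p = p \<and> A \<in> p)"

definition central_star_near :: "'a::semitopological_semigroup_add \<Rightarrow> 'a set \<Rightarrow> 'a set \<Rightarrow> bool" where
  "central_star_near e S = star_family (central_near e S) S"

text \<open>Addition need not be commutative, so the sum over a finite nonempty index set is taken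
  in increasing order of the indices. Sequences are indexed by \<^typ>\<open>nat\<close>, with first
  index \<open>0\<close>.\<close>

definition ordered_sum :: "(nat \<Rightarrow> 'a::plus) \<Rightarrow> nat set \<Rightarrow> 'a" where
  "ordered_sum x F =
     (let ns = sorted_list_of_set F in foldl (\<lambda>s n. s + x n) (x (hd ns)) (tl ns))"

definition FS :: "(nat \<Rightarrow> 'a::plus) \<Rightarrow> nat \<Rightarrow> 'a set" where
  "FS x m = {ordered_sum x F | F. finite F \<and> F \<noteq> {} \<and> (\<forall>n\<in>F. m \<le> n)}"

definition converges_near :: "'a::semitopological_semigroup_add \<Rightarrow> (nat \<Rightarrow> 'a) \<Rightarrow> bool" where
  "converges_near e x \<longleftrightarrow> (\<forall>U \<in> neighborhoods e. \<exists>m. FS x m \<subseteq> U)"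

definition IP_near :: "'a::semitopological_semigroup_add \<Rightarrow> 'a set \<Rightarrow> 'a set \<Rightarrow> bool" where
  "IP_near e S A \<longleftrightarrow> A \<subseteq> S \<and>
     (\<exists>x. (\<forall>n. x n \<in> S) \<and> converges_near e x \<and> FS x 0 \<subseteq> A)"

definition IP_star_near :: "'a::semitopological_semigroup_add \<Rightarrow> 'a set \<Rightarrow> 'a set \<Rightarrow> bool" where
  "IP_star_near e S = star_family (IP_near e S) S"

definition countable_local_base :: "'a::topological_space \<Rightarrow> bool" where
  "countable_local_base e \<longleftrightarrow>
     (\<exists>\<W>. countable \<W> \<and> \<W> \<subseteq> neighborhoods e \<and> (\<forall>U \<in> neighborhoods e. \<exists>W\<in>\<W>. W \<subseteq> U))"

definition decreasing_local_base :: "'a::topological_space \<Rightarrow> (nat \<Rightarrow> 'a set) \<Rightarrow> bool" where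
  "decreasing_local_base e W \<longleftrightarrow>
     (\<forall>n. W n \<in> neighborhoods e) \<and> (\<forall>n. W (Suc n) \<subseteq> W n) \<and>
     (\<forall>U \<in> neighborhoods e. \<exists>n. W n \<subseteq> U)"

definition piecewise_syndetic_near_wrt ::
  "(nat \<Rightarrow> 'a set) \<Rightarrow> 'a::semitopological_semigroup_add \<Rightarrow> 'a set \<Rightarrow> 'a set \<Rightarrow> bool" where
  "piecewise_syndetic_near_wrt W e S A \<longleftrightarrow> A \<subseteq> S \<and>
     (\<exists>F V. (\<forall>n. finite (F n) \<and> F n \<noteq> {} \<and> F n \<subseteq> W n \<inter> S) \<and>
            (\<forall>n. V n \<in> neighborhoods e \<and> V n \<subseteq> W n) \<and>
            (\<forall>G U. finite G \<and> G \<noteq> {} \<and> G \<subseteq> S \<and> U \<in> neighborhoods e \<longrightarrow>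
               (\<exists>x \<in> U \<inter> S. \<forall>n. (\<lambda>g. g + x) ` (G \<inter> V n) \<subseteq> (\<Union>t \<in> F n. shift S t A))))"

lemma piecewise_syndetic_near_wrt_base_independent:
  assumes W: "decreasing_local_base e W" and W': "decreasing_local_base e W'"
    and ps: "piecewise_syndetic_near_wrt W e S A"
  shows "piecewise_syndetic_near_wrt W' e S A"
proof -
  have "\<forall>n. \<exists>k. W k \<subseteq> W' n"
    using W W' unfolding decreasing_local_base_def by simp
  from choice[OF this] obtain k where k: "\<And>n. W (k n) \<subseteq> W' n"
    by blast
  from ps have A: "A \<subseteq> S"
    unfolding piecewise_syndetic_near_wrt_def by (rule conjunct1)
  from ps obtain F V where F: "\<forall>n. finite (F n) \<and> F n \<noteq> {} \<and> F n \<subseteq> W n \<inter> S"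
    and V: "\<forall>n. V n \<in> neighborhoods e \<and> V n \<subseteq> W n"
    and FV: "\<forall>G U. finite G \<and> G \<noteq> {} \<and> G \<subseteq> S \<and> U \<in> neighborhoods e \<longrightarrow>
               (\<exists>x \<in> U \<inter> S. \<forall>n. (\<lambda>g. g + x) ` (G \<inter> V n) \<subseteq> (\<Union>t \<in> F n. shift S t A))"
    unfolding piecewise_syndetic_near_wrt_def by (elim conjE exE)
  have F': "\<forall>n. finite (F (k n)) \<and> F (k n) \<noteq> {} \<and> F (k n) \<subseteq> W' n \<inter> S"
    using F k by (meson le_inf_iff order_trans)
  have V': "\<forall>n. V (k n) \<in> neighborhoods e \<and> V (k n) \<subseteq> W' n"
    using V k by (meson order_trans)
  have FV': "\<forall>G U. finite G \<and> G \<noteq> {} \<and> G \<subseteq> S \<and> U \<in> neighborhoods e \<longrightarrow>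
      (\<exists>x \<in> U \<inter> S. \<forall>n. (\<lambda>g. g + x) ` (G \<inter> V (k n)) \<subseteq> (\<Union>t \<in> F (k n). shift S t A))"
    using FV by meson
  show ?thesis
    unfolding piecewise_syndetic_near_wrt_def
    by (rule conjI[OF A], rule exI[of _ "\<lambda>n. F (k n)"], rule exI[of _ "\<lambda>n. V (k n)"])
       (rule conjI[OF F' conjI[OF V' FV']])
qed

text \<open>By the preceding lemma the choice of the decreasing local base is immaterial. The notion
  is meaningful only when \<open>e\<close> has a countable local base.\<close>

definition piecewise_syndetic_near ::
  "'a::semitopological_semigroup_add \<Rightarrow> 'a set \<Rightarrow> 'a set \<Rightarrow> bool" where
  "piecewise_syndetic_near e S A \<longleftrightarrow>
     (\<exists>W. decreasing_local_base e W \<and> piecewise_syndetic_near_wrt W e S A)"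

lemma piecewise_syndetic_near_iff_wrt:
  assumes "decreasing_local_base e W"
  shows "piecewise_syndetic_near e S A \<longleftrightarrow> piecewise_syndetic_near_wrt W e S A"
  using assms piecewise_syndetic_near_wrt_base_independent
  unfolding piecewise_syndetic_near_def by blast

definition PS_star_near :: "'a::semitopological_semigroup_add \<Rightarrow> 'a set \<Rightarrow> 'a set \<Rightarrow> bool" where
  "PS_star_near e S = star_family (piecewise_syndetic_near e S) S"

end

theory Submission
  imports Defs
begin

text \<open>Coordinate projections, the diagonal embedding \<open>S \<rightarrow> E\<close> and the inclusion \<open>I \<rightarrow> E\<close> induce
  homomorphisms between the semigroups of ultrafilters near the idempotents. Given a minimal
  idempotent \<open>p\<close> near \<open>e\<close>, choose a minimal idempotent below its diagonal image; each of its
  projections is an idempotent below \<open>p\<close> and hence equals \<open>p\<close>, and since the ultrafilters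
  containing \<open>I\<close> form an ideal, it lives on \<open>I\<close>. This gives (1), and (2) after multiplying by
  the diagonal image of an arbitrary \<open>p\<close> in the smallest ideal, because the piecewise
  syndetic sets are the members of ultrafilters in the smallest ideal. Conversely, the closure
  hypothesis makes the projections map onto a right ideal, so they send the smallest ideal of \<open>I\<close>
  into that of \<open>S\<close>, which gives (3) and (4). For (5), a sum subsystem of an IP sequence in \<open>I\<close>
  avoiding \<open>B\<close> in one coordinate would project to an IP set near \<open>e\<close> disjoint from \<open>B\<close>.\<close>

section \<open>Compact right topological semigroups\<close>

text \<open>Ultrafilters on \<open>S\<close>, \<open>E\<close> and \<open>I\<close> are families of
  subsets of different carriers, so those on \<open>I\<close> are not literally ultrafilters on
  \<open>E\<close>. Every comparison runs through image ultrafilters, and the inclusion has to be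
  shown injective with an ideal as range before smallest ideals can be moved along it. The detour
  through \<open>E\<close> is forced by the diagonal: constant tuples lie in \<open>E\<close>, but
  not necessarily in \<open>I\<close>. The sum of ultrafilters is continuous in its left argument
  for every fixed right argument. Hence the structure theory is one-sided: translates
  \<open>X \<oplus> y\<close> are closed, minimal left ideals exist, and idempotents are found
  inside them. For piecewise syndetic sets one translate must serve all levels \<open>n\<close> of
  the local base at once. Since \<open>e\<close> lies outside \<open>S\<close>, each point of
  \<open>S\<close> belongs to only finitely many sets of a decreasing base, so only finitely many
  conditions remain and a single ultrafilter can meet them.\<close>

locale compact_right_topological_semigroup =
  fixes T :: "'b topology" and f :: "'b \<Rightarrow> 'b \<Rightarrow> 'b" (infixl \<open>\<oplus>\<close> 65)
  assumes compact: "compact_space T"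
    and Hausdorff: "Hausdorff_space T"
    and nonempty: "topspace T \<noteq> {}"
    and closed: "\<lbrakk>x \<in> topspace T; y \<in> topspace T\<rbrakk> \<Longrightarrow> x \<oplus> y \<in> topspace T"
    and assoc: "\<lbrakk>x \<in> topspace T; y \<in> topspace T; z \<in> topspace T\<rbrakk> \<Longrightarrow> x \<oplus> y \<oplus> z = x \<oplus> (y \<oplus> z)"
    and continuous: "y \<in> topspace T \<Longrightarrow> continuous_map T T (\<lambda>x. x \<oplus> y)"
begin

abbreviation "X \<equiv> topspace T"
abbreviation "K \<equiv> smallest_ideal f X"

text \<open>Zorn's lemma yields maximal sets, hence the passage to complements. A chain of nonempty
  closed sets has nonempty intersection by compactness, because a finite nonempty subfamily contains
  its own intersection. With \<open>P\<close> left open, closed subsemigroups and closed left ideals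
  are covered by one argument.\<close>

lemma minimal_closed_set_exists:
  assumes "closedin T A" "A \<noteq> {}" "P A"
    and Inter: "\<And>\<C>. \<lbrakk>\<C> \<noteq> {}; \<forall>C\<in>\<C>. P C\<rbrakk> \<Longrightarrow> P (\<Inter>\<C>)"
  obtains M where "closedin T M" "M \<noteq> {}" "P M" "M \<subseteq> A"
    "\<And>C. \<lbrakk>closedin T C; C \<noteq> {}; P C; C \<subseteq> M\<rbrakk> \<Longrightarrow> C = M"
proof -
  define \<A> where "\<A> = {C. closedin T C \<and> C \<noteq> {} \<and> P C \<and> C \<subseteq> A}"
  have "\<exists>U\<in>uminus ` \<A>. \<forall>D\<in>\<D>. D \<subseteq> U" if chain: "subset.chain (uminus ` \<A>) \<D>" for \<D>
  proof (cases "\<D> = {}")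
    case True
    then show ?thesis using assms(1-3) by (auto simp: \<A>_def)
  next
    case False
    define \<C> where "\<C> = uminus ` \<D>"
    have sub: "\<C> \<subseteq> \<A>"
      using chain by (auto simp: \<C>_def subset_chain_def)
    have tot: "C \<subseteq> D \<or> D \<subseteq> C" if "C \<in> \<C>" "D \<in> \<C>" for C D
    proof -
      have "- C \<in> \<D>" "- D \<in> \<D>" using that by (auto simp: \<C>_def)
      then show ?thesis using chain Compl_subset_Compl_iff unfolding subset_chain_def by blast
    qed
    have "\<Inter>\<F> \<in> \<F>" if "finite \<F>" "\<F> \<noteq> {}" "\<F> \<subseteq> \<C>" for \<F>
      using that
    proof (induction \<F> rule: finite_ne_induct)
      case (insert C \<F>)
      then have "C \<subseteq> \<Inter>\<F> \<or> \<Inter>\<F> \<subseteq> C" by (intro tot) auto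
      with insert show ?case by (auto simp: inf.absorb1 inf.absorb2)
    qed auto
    then have "\<Inter>\<F> \<noteq> {}" if "finite \<F>" "\<F> \<subseteq> \<C>" for \<F>
      using that sub unfolding \<A>_def by (cases "\<F> = {}") blast+
    moreover have "\<forall>C\<in>\<C>. closedin T C" using sub by (auto simp: \<A>_def)
    ultimately have "\<Inter>\<C> \<noteq> {}"
      using compact[unfolded compact_space_fip, rule_format, of \<C>] by simp
    moreover have ne: "\<C> \<noteq> {}" using False by (simp add: \<C>_def)
    moreover have "closedin T (\<Inter>\<C>)" using ne sub by (auto simp: \<A>_def)
    moreover have "P (\<Inter>\<C>)" using ne sub by (intro Inter) (auto simp: \<A>_def)
    moreover have "\<Inter>\<C> \<subseteq> A" using ne sub by (auto simp: \<A>_def)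
    ultimately have "\<Inter>\<C> \<in> \<A>" by (auto simp: \<A>_def)
    moreover have "D \<subseteq> - \<Inter>\<C>" if "D \<in> \<D>" for D using that by (auto simp: \<C>_def)
    ultimately show ?thesis by blast
  qed
  from subset_Zorn[OF this] obtain M where M: "M \<in> \<A>" "\<And>C. \<lbrakk>C \<in> \<A>; C \<subseteq> M\<rbrakk> \<Longrightarrow> C = M"
    by (auto simp: image_iff)
  show thesis
  proof (rule that)
    show "C = M" if "closedin T C" "C \<noteq> {}" "P C" "C \<subseteq> M" for C
      using that M by (auto simp: \<A>_def)
  qed (use M(1) in \<open>auto simp: \<A>_def\<close>)
qed

lemma closedin_translate:
  assumes "closedin T A" "y \<in> X"
  shows "closedin T ((\<lambda>x. x \<oplus> y) ` A)"
  by (rule compactin_imp_closedin[OF Hausdorff image_compactin[OF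
        closedin_compact_space[OF compact assms(1)] continuous[OF assms(2)]]])

text \<open>Ellis' lemma. In a minimal closed subsemigroup \<open>M\<close> each translate
  \<open>M \<oplus> x\<close> is again a closed subsemigroup, hence all of \<open>M\<close>. So the
  left identities of \<open>x\<close> in \<open>M\<close> form a nonempty closed subsemigroup, which
  by minimality is \<open>M\<close> and therefore contains \<open>x\<close>.\<close>

lemma idempotent_exists:
  assumes "closedin T A" "A \<noteq> {}" "\<And>x y. \<lbrakk>x \<in> A; y \<in> A\<rbrakk> \<Longrightarrow> x \<oplus> y \<in> A"
  obtains u where "u \<in> A" "u \<oplus> u = u"
proof -
  define P where "P M \<longleftrightarrow> (\<forall>x\<in>M. \<forall>y\<in>M. x \<oplus> y \<in> M)" for M
  obtain M where M: "closedin T M" "M \<noteq> {}" "P M" "M \<subseteq> A"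
    and min: "\<And>C. \<lbrakk>closedin T C; C \<noteq> {}; P C; C \<subseteq> M\<rbrakk> \<Longrightarrow> C = M"
    by (rule minimal_closed_set_exists[of A P]) (use assms in \<open>auto simp: P_def\<close>)
  obtain x where x: "x \<in> M" using M by blast
  have MX: "M \<subseteq> X" using M(1) closedin_subset by blast
  have sum: "a \<oplus> b \<in> M" if "a \<in> M" "b \<in> M" for a b
    using M(3) that by (simp add: P_def)
  have "(\<lambda>a. a \<oplus> x) ` M = M"
  proof (rule min)
    show "P ((\<lambda>a. a \<oplus> x) ` M)"
      unfolding P_def
    proof clarify
      fix a b assume ab: "a \<in> M" "b \<in> M"
      then have "a \<oplus> x \<oplus> (b \<oplus> x) = a \<oplus> x \<oplus> b \<oplus> x"
        using sum x MX by (intro assoc[symmetric]) auto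
      then show "a \<oplus> x \<oplus> (b \<oplus> x) \<in> (\<lambda>a. a \<oplus> x) ` M"
        using sum[OF sum[OF ab(1) x] ab(2)] by blast
    qed
    show "closedin T ((\<lambda>a. a \<oplus> x) ` M)"
      using M(1) x MX by (intro closedin_translate) auto
  qed (use x sum in auto)
  then obtain y where y: "y \<in> M" "y \<oplus> x = x" using x by force
  have "{a \<in> M. a \<oplus> x = x} = M"
  proof (rule min)
    have "closedin T {a \<in> X. a \<oplus> x \<in> {x}}"
      using x MX by (intro closedin_continuous_map_preimage[OF continuous] closedin_Hausdorff_singleton Hausdorff) auto
    then have "closedin T (M \<inter> {a \<in> X. a \<oplus> x \<in> {x}})" using M(1) by blast
    also have "M \<inter> {a \<in> X. a \<oplus> x \<in> {x}} = {a \<in> M. a \<oplus> x = x}" using MX by auto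
    finally show "closedin T {a \<in> M. a \<oplus> x = x}" .
    show "P {a \<in> M. a \<oplus> x = x}"
      unfolding P_def using sum x MX by (auto simp: assoc subset_iff)
  qed (use y in auto)
  then show thesis using x M(4) that by blast
qed

section \<open>Minimal left ideals and the structure of the smallest ideal\<close>

text \<open>Minimality is encoded by generation from any single element. This is equivalent to being
  minimal among left ideals, and it allows equations \<open>l = x \<oplus> m\<close> inside
  \<open>L\<close> to be solved for \<open>x\<close> at once.\<close>

definition minimal_left_ideal :: "'b set \<Rightarrow> bool" where
  "minimal_left_ideal L \<longleftrightarrow> L \<noteq> {} \<and> L \<subseteq> X \<and> (\<forall>m\<in>L. (\<lambda>x. x \<oplus> m) ` X = L)"

lemma minimal_left_idealD:
  assumes "minimal_left_ideal L"
  shows "L \<noteq> {}" "L \<subseteq> X" "\<And>m. m \<in> L \<Longrightarrow> (\<lambda>x. x \<oplus> m) ` X = L"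
    "\<And>x m. \<lbrakk>x \<in> X; m \<in> L\<rbrakk> \<Longrightarrow> x \<oplus> m \<in> L"
  using assms unfolding minimal_left_ideal_def by blast+

text \<open>Minimality among closed left ideals suffices, since the left ideal
  \<open>X \<oplus> m\<close> generated by a point is itself closed.\<close>

lemma minimal_left_ideal_exists:
  assumes "p \<in> X"
  obtains L where "minimal_left_ideal L" "L \<subseteq> (\<lambda>x. x \<oplus> p) ` X"
proof -
  define P where "P M \<longleftrightarrow> (\<forall>x\<in>X. \<forall>y\<in>M. x \<oplus> y \<in> M)" for M
  have P: "P ((\<lambda>x. x \<oplus> q) ` X)" if "q \<in> X" for q
    unfolding P_def
  proof (intro ballI, clarify)
    fix x y assume "x \<in> X" "y \<in> X"
    then show "x \<oplus> (y \<oplus> q) \<in> (\<lambda>x. x \<oplus> q) ` X"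
      using that by (intro image_eqI[of _ _ "x \<oplus> y"]) (simp_all add: assoc closed)
  qed
  obtain M where M: "closedin T M" "M \<noteq> {}" "P M" "M \<subseteq> (\<lambda>x. x \<oplus> p) ` X"
    and min: "\<And>C. \<lbrakk>closedin T C; C \<noteq> {}; P C; C \<subseteq> M\<rbrakk> \<Longrightarrow> C = M"
  proof (rule minimal_closed_set_exists)
    show "closedin T ((\<lambda>x. x \<oplus> p) ` X)" using assms by (intro closedin_translate) auto
    show "P ((\<lambda>x. x \<oplus> p) ` X)" using assms by (rule P)
    show "P (\<Inter>\<C>)" if "\<forall>C\<in>\<C>. P C" for \<C> using that by (simp add: P_def)
  qed (use nonempty in auto)
  have MX: "M \<subseteq> X" using M(1) closedin_subset by blast
  have "(\<lambda>x. x \<oplus> m) ` X = M" if "m \<in> M" for m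
  proof (rule min)
    show "closedin T ((\<lambda>x. x \<oplus> m) ` X)" using that MX by (intro closedin_translate) auto
    show "P ((\<lambda>x. x \<oplus> m) ` X)" using that MX by (intro P) auto
    show "(\<lambda>x. x \<oplus> m) ` X \<subseteq> M" using that M(3) by (auto simp: P_def)
  qed (use nonempty in auto)
  then have "minimal_left_ideal M" using M MX by (auto simp: minimal_left_ideal_def)
  then show thesis using M(4) that by blast
qed

text \<open>This supplies the right absorption that makes the union of all minimal left ideals
  two-sided.\<close>

lemma minimal_left_ideal_translate:
  assumes L: "minimal_left_ideal L" and q: "q \<in> X"
  shows "minimal_left_ideal ((\<lambda>x. x \<oplus> q) ` L)"
proof -
  have LX: "L \<subseteq> X" and LL: "\<And>m. m \<in> L \<Longrightarrow> (\<lambda>x. x \<oplus> m) ` X = L"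
    using L by (auto simp: minimal_left_ideal_def)
  have "(\<lambda>x. x \<oplus> (m \<oplus> q)) ` X = (\<lambda>x. x \<oplus> q) ` L" if "m \<in> L" for m
  proof -
    have "(\<lambda>x. x \<oplus> (m \<oplus> q)) ` X = (\<lambda>x. x \<oplus> q) ` (\<lambda>x. x \<oplus> m) ` X"
      using that LX q by (auto simp: image_image assoc subset_iff intro!: image_cong)
    then show ?thesis using LL[OF that] by simp
  qed
  then show ?thesis
    using L q closed unfolding minimal_left_ideal_def by auto
qed

text \<open>For \<open>j\<close> in an ideal and \<open>l\<close> in \<open>L\<close>, the element
  \<open>j \<oplus> l\<close> still generates \<open>L\<close>, so
  \<open>l = x \<oplus> (j \<oplus> l)\<close> lies in the ideal.\<close>

lemma minimal_left_ideal_subset_smallest_ideal: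
  assumes L: "minimal_left_ideal L"
  shows "L \<subseteq> K"
  unfolding smallest_ideal_def
proof (intro Inter_greatest, clarify)
  fix J l assume J: "semigroup_ideal f X J" and l: "l \<in> L"
  then obtain j where j: "j \<in> J" by (auto simp: semigroup_ideal_def)
  have jX: "j \<in> X" and lX: "l \<in> X"
    using J j l minimal_left_idealD(2)[OF L] by (auto simp: semigroup_ideal_def)
  have "j \<oplus> l \<in> L" using L jX l by (rule minimal_left_idealD(4))
  then have "l \<in> (\<lambda>x. x \<oplus> (j \<oplus> l)) ` X" using minimal_left_idealD(3)[OF L] l by blast
  then obtain x where x: "x \<in> X" "l = x \<oplus> (j \<oplus> l)" by blast
  have "j \<oplus> l \<in> J" using J j lX by (simp add: semigroup_ideal_def)
  then have "x \<oplus> (j \<oplus> l) \<in> J" using J x(1) by (simp add: semigroup_ideal_def)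
  then show "l \<in> J" using x(2) by simp
qed

lemma smallest_ideal_eq_Union: "K = \<Union>{L. minimal_left_ideal L}"
proof
  obtain x where "x \<in> X" using nonempty by blast
  then obtain L where L: "minimal_left_ideal L" by (rule minimal_left_ideal_exists)
  have "semigroup_ideal f X (\<Union>{L. minimal_left_ideal L})"
    unfolding semigroup_ideal_def
  proof (intro conjI ballI)
    fix x j assume x: "x \<in> X" and "j \<in> \<Union>{L. minimal_left_ideal L}"
    then obtain L where L: "minimal_left_ideal L" "j \<in> L" by blast
    then show "x \<oplus> j \<in> \<Union>{L. minimal_left_ideal L}"
      using minimal_left_idealD(4)[OF L(1) x L(2)] by blast
    show "j \<oplus> x \<in> \<Union>{L. minimal_left_ideal L}"
      using minimal_left_ideal_translate[OF L(1) x] L(2) by blast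
  next
    show "\<Union>{L. minimal_left_ideal L} \<noteq> {}" using L minimal_left_idealD(1)[OF L] by auto
    show "\<Union>{L. minimal_left_ideal L} \<subseteq> X"
      by (rule Union_least) (simp add: minimal_left_idealD(2))
  qed
  then show "K \<subseteq> \<Union>{L. minimal_left_ideal L}"
    unfolding smallest_ideal_def by (intro Inter_lower) simp
  show "\<Union>{L. minimal_left_ideal L} \<subseteq> K"
    by (rule Union_least) (simp add: minimal_left_ideal_subset_smallest_ideal)
qed

text \<open>The delicate point is nonemptiness: an intersection of ideals might be empty, but here
  it contains a minimal left ideal.\<close>

lemma semigroup_ideal_smallest_ideal: "semigroup_ideal f X K"
proof -
  obtain x where "x \<in> X" using nonempty by blast
  then obtain L where "minimal_left_ideal L" by (rule minimal_left_ideal_exists)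
  then have "K \<noteq> {}"
    using minimal_left_ideal_subset_smallest_ideal[of L] minimal_left_idealD(1)[of L] by auto
  moreover have "semigroup_ideal f X X"
    using nonempty closed by (auto simp: semigroup_ideal_def)
  then have "K \<subseteq> X" unfolding smallest_ideal_def by (intro Inter_lower) simp
  moreover have "x \<oplus> k \<in> K \<and> k \<oplus> x \<in> K" if "x \<in> X" "k \<in> K" for x k
    using that unfolding smallest_ideal_def by (simp add: semigroup_ideal_def)
  ultimately show ?thesis by (simp add: semigroup_ideal_def)
qed

lemma smallest_ideal_subset: "K \<subseteq> X"
  using semigroup_ideal_smallest_ideal by (simp add: semigroup_ideal_def)

text \<open>This solvability is how membership in \<open>K\<close> gets used later: it gives
  minimality of idempotents and, for ultrafilters, the covering behind piecewise
  syndeticity.\<close>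

lemma smallest_ideal_left_inverse:
  assumes "p \<in> K" "q \<in> X"
  obtains r where "r \<in> X" "r \<oplus> (q \<oplus> p) = p"
proof -
  obtain L where L: "minimal_left_ideal L" "p \<in> L" using assms(1) smallest_ideal_eq_Union by auto
  have "q \<oplus> p \<in> L" using L(1) assms(2) L(2) by (rule minimal_left_idealD(4))
  then have "p \<in> (\<lambda>x. x \<oplus> (q \<oplus> p)) ` X" using minimal_left_idealD(3) L by blast
  then obtain r where "r \<in> X" "p = r \<oplus> (q \<oplus> p)" by blast
  then show thesis using that[of r] by simp
qed

lemma minimal_left_ideal_idempotent:
  assumes L: "minimal_left_ideal L"
  obtains u where "u \<in> L" "u \<oplus> u = u"
proof (rule idempotent_exists)
  obtain m where m: "m \<in> L" "m \<in> X" using minimal_left_idealD(1,2)[OF L] by blast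
  then have "closedin T ((\<lambda>x. x \<oplus> m) ` X)" by (simp add: closedin_translate)
  then show "closedin T L" using minimal_left_idealD(3)[OF L m(1)] by simp
qed (use minimal_left_idealD(1,2,4)[OF L] in blast)+

text \<open>An idempotent \<open>u\<close> of a minimal left ideal \<open>L = X \<oplus> u\<close>
  is a right identity on all of \<open>L\<close>.\<close>

lemma smallest_ideal_right_identity:
  assumes "p \<in> K"
  obtains u where "u \<in> K" "u \<oplus> u = u" "p \<oplus> u = p"
proof -
  obtain L where L: "minimal_left_ideal L" "p \<in> L" using assms(1) smallest_ideal_eq_Union by auto
  obtain u where u: "u \<in> L" "u \<oplus> u = u" using L(1) by (rule minimal_left_ideal_idempotent)
  have "p \<in> (\<lambda>x. x \<oplus> u) ` X" using minimal_left_idealD(3)[OF L(1) u(1)] L(2) by blast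
  then obtain x where "x \<in> X" "p = x \<oplus> u" by blast
  moreover have "u \<in> X" using u(1) minimal_left_idealD(2)[OF L(1)] by blast
  ultimately have "p \<oplus> u = p" using u by (simp add: assoc)
  moreover have "u \<in> K" using u L smallest_ideal_eq_Union by auto
  ultimately show thesis using u that by blast
qed

text \<open>An idempotent \<open>w\<close> of a minimal left ideal inside
  \<open>X \<oplus> p\<close> satisfies \<open>w \<oplus> p = w\<close>, but possibly not
  \<open>p \<oplus> w = w\<close>. Passing to \<open>p \<oplus> w\<close> repairs the left side and
  keeps the right one.\<close>

lemma smallest_ideal_idempotent_below:
  assumes p: "p \<in> X" "p \<oplus> p = p"
  obtains q where "q \<in> K" "q \<oplus> q = q" "p \<oplus> q = q" "q \<oplus> p = q"
proof -
  obtain L where L: "minimal_left_ideal L" "L \<subseteq> (\<lambda>x. x \<oplus> p) ` X"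
    using p(1) by (rule minimal_left_ideal_exists)
  obtain w where w: "w \<in> L" "w \<oplus> w = w" using L(1) by (rule minimal_left_ideal_idempotent)
  have wX: "w \<in> X" and wK: "w \<in> K"
    using w(1) minimal_left_idealD(2)[OF L(1)] minimal_left_ideal_subset_smallest_ideal[OF L(1)] by blast+
  obtain x where "x \<in> X" "w = x \<oplus> p" using w L by auto
  then have wp: "w \<oplus> p = w" using p by (simp add: assoc)
  show thesis
  proof
    show "p \<oplus> w \<in> K"
      using semigroup_ideal_smallest_ideal wK p by (simp add: semigroup_ideal_def)
    show "p \<oplus> w \<oplus> (p \<oplus> w) = p \<oplus> w"
    proof -
      have "p \<oplus> w \<oplus> (p \<oplus> w) = p \<oplus> (w \<oplus> p \<oplus> w)" using wX p by (simp add: assoc closed)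
      then show ?thesis using wp w(2) by simp
    qed
    show "p \<oplus> (p \<oplus> w) = p \<oplus> w" using assoc[OF p(1) p(1) wX] p(2) by simp
    show "p \<oplus> w \<oplus> p = p \<oplus> w" using wX wp p by (simp add: assoc)
  qed
qed

text \<open>Writing \<open>p = r \<oplus> q\<close> shows that right addition of the idempotent
  \<open>q\<close> fixes \<open>p\<close>, while by hypothesis it turns \<open>p\<close> into
  \<open>q\<close>.\<close>

lemma smallest_ideal_idempotent_minimal:
  assumes "p \<in> K" "q \<in> X" "q \<oplus> q = q" "p \<oplus> q = q" "q \<oplus> p = q"
  shows "q = p"
proof -
  obtain r where "r \<in> X" "r \<oplus> (q \<oplus> p) = p" using assms(1,2) by (rule smallest_ideal_left_inverse)
  then have "r \<oplus> q = p" using assms(5) by simp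
  then have "p \<oplus> q = r \<oplus> (q \<oplus> q)" using assoc[OF \<open>r \<in> X\<close> assms(2,2)] by simp
  then show ?thesis using assms(3,4) \<open>r \<oplus> q = p\<close> by simp
qed

end

section \<open>Smallest ideals under homomorphisms\<close>

text \<open>This is the inclusion of \<open>K(X)\<close> in \<open>K(Y)\<close> for an ideal
  \<open>Y\<close> of \<open>X\<close>, with an injective homomorphism \<open>h\<close> in place of
  the set inclusion.\<close>

lemma smallest_ideal_preimage:
  assumes "x \<in> smallest_ideal g X" and inj: "inj_on h Y" and ideal: "semigroup_ideal g X (h ` Y)"
    and hom: "\<And>a b. \<lbrakk>a \<in> Y; b \<in> Y\<rbrakk> \<Longrightarrow> h (f a b) = g (h a) (h b)"
    and assoc: "\<And>a b c. \<lbrakk>a \<in> X; b \<in> X; c \<in> X\<rbrakk> \<Longrightarrow> g (g a b) c = g a (g b c)"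
    and closed: "\<And>a b. \<lbrakk>a \<in> Y; b \<in> Y\<rbrakk> \<Longrightarrow> f a b \<in> Y"
  obtains y where "y \<in> smallest_ideal f Y" "h y = x"
proof -
  have "x \<in> h ` Y" using assms(1) ideal by (auto simp: smallest_ideal_def)
  then obtain y where y: "y \<in> Y" "h y = x" by blast
  have "y \<in> J" if J: "semigroup_ideal f Y J" for J
  proof -
    \<comment> \<open>An ideal \<open>J\<close> of \<open>Y\<close> need not be an ideal of the
      ambient semigroup, but \<open>Y + J + Y\<close> is one: an outer summand is absorbed by the
      neighbouring element of \<open>Y\<close> and never touches \<open>J\<close>.\<close>
    define J' where "J' = {f (f a j) b | a j b. a \<in> Y \<and> j \<in> J \<and> b \<in> Y}"
    have JY: "J \<subseteq> Y" "J \<noteq> {}" using J by (auto simp: semigroup_ideal_def)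
    have J'J: "J' \<subseteq> J" using J by (auto simp: semigroup_ideal_def J'_def)
    have YX: "h a \<in> X" if "a \<in> Y" for a using that ideal by (auto simp: semigroup_ideal_def)
    have "semigroup_ideal g X (h ` J')"
      unfolding semigroup_ideal_def
    proof (intro conjI ballI)
      show "h ` J' \<noteq> {}" using JY(2) y(1) unfolding J'_def by blast
      show "h ` J' \<subseteq> X" using J'J JY YX by auto
      fix z w assume z: "z \<in> X" and "w \<in> h ` J'"
      then obtain a j b where w: "w = h (f (f a j) b)" "a \<in> Y" "j \<in> J" "b \<in> Y" by (auto simp: J'_def)
      have w': "w = g (g (h a) (h j)) (h b)" using w JY by (auto simp: hom closed subset_iff)
      have jY: "j \<in> Y" using w JY by blast
      have "g z (h a) \<in> h ` Y" using z w ideal by (auto simp: semigroup_ideal_def)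
      then obtain a' where a': "a' \<in> Y" "h a' = g z (h a)" by auto
      have "g (h b) z \<in> h ` Y" using z w ideal by (auto simp: semigroup_ideal_def)
      then obtain b' where b': "b' \<in> Y" "h b' = g (h b) z" by auto
      have c: "g (h a) (h j) \<in> X" using YX[OF closed[OF w(2) jY]] w(2) jY by (simp add: hom)
      have "g z w = h (f (f a' j) b)"
      proof -
        have "g z w = g (g z (g (h a) (h j))) (h b)"
          using w' z c YX[OF w(4)] by (simp add: assoc)
        also have "g z (g (h a) (h j)) = h (f a' j)"
          using assoc[OF z YX[OF w(2)] YX[OF jY]] a' jY by (simp add: hom)
        finally show ?thesis using a'(1) jY w(4) by (simp add: hom closed)
      qed
      then show "g z w \<in> h ` J'" using a'(1) w(3,4) unfolding J'_def by blast
      have "g w z = h (f (f a j) b')"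
      proof -
        have "g w z = g (g (h a) (h j)) (g (h b) z)"
          using w' z c YX[OF w(4)] by (simp add: assoc)
        then show ?thesis using b' jY w(2) by (simp add: hom closed)
      qed
      then show "g w z \<in> h ` J'" using b'(1) w(2,3) unfolding J'_def by blast
    qed
    then have "h y \<in> h ` J'" using assms(1) y by (auto simp: smallest_ideal_def)
    then show "y \<in> J" using inj y J'J JY by (auto simp: inj_on_def)
  qed
  then show thesis using that y by (auto simp: smallest_ideal_def)
qed

text \<open>The preimage of an ideal is an ideal as soon as it is nonempty. Nonemptiness comes from
  \<open>range\<close>: the product of \<open>h y\<close> with an element of \<open>J\<close> lies
  in \<open>J\<close> and in the image of \<open>h\<close>. Right absorption thus does the work of
  surjectivity.\<close>

lemma smallest_ideal_image:
  assumes "y \<in> smallest_ideal f Y" "y \<in> Y"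
    and hom: "\<And>a b. \<lbrakk>a \<in> Y; b \<in> Y\<rbrakk> \<Longrightarrow> h (f a b) = g (h a) (h b)"
    and closed: "\<And>a b. \<lbrakk>a \<in> Y; b \<in> Y\<rbrakk> \<Longrightarrow> f a b \<in> Y"
    and hX: "h ` Y \<subseteq> X"
    and range: "\<And>a b. \<lbrakk>a \<in> Y; b \<in> X\<rbrakk> \<Longrightarrow> g (h a) b \<in> h ` Y"
  shows "h y \<in> smallest_ideal g X"
  unfolding smallest_ideal_def
proof clarify
  fix J assume J: "semigroup_ideal g X J"
  then obtain j where j: "j \<in> J" "j \<in> X" by (auto simp: semigroup_ideal_def)
  then have "g (h y) j \<in> h ` Y" using assms(2) range by blast
  moreover have "g (h y) j \<in> J" using J j assms(2) hX by (auto simp: semigroup_ideal_def)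
  ultimately have "{a \<in> Y. h a \<in> J} \<noteq> {}" by auto
  then have "semigroup_ideal f Y {a \<in> Y. h a \<in> J}"
    using J hX by (auto simp: semigroup_ideal_def closed hom)
  then show "h y \<in> J" using assms(1) by (auto simp: smallest_ideal_def)
qed

section \<open>Ultrafilters near an idempotent\<close>

lemma
  assumes "p \<in> beta S"
  shows beta_subset: "A \<in> p \<Longrightarrow> A \<subseteq> S"
    and beta_space: "S \<in> p"
    and beta_nonempty: "A \<in> p \<Longrightarrow> A \<noteq> {}"
    and beta_Int: "\<lbrakk>A \<in> p; B \<in> p\<rbrakk> \<Longrightarrow> A \<inter> B \<in> p"
    and beta_mono: "\<lbrakk>A \<in> p; A \<subseteq> B; B \<subseteq> S\<rbrakk> \<Longrightarrow> B \<in> p"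
    and beta_cases: "A \<subseteq> S \<Longrightarrow> A \<in> p \<or> S - A \<in> p"
proof -
  note p = assms[unfolded beta_def mem_Collect_eq]
  have 0: "p \<subseteq> Pow S \<and> {} \<notin> p" using p by simp
  show "S \<in> p" using p by (elim conjE)
  show "A \<subseteq> S" "A \<noteq> {}" if "A \<in> p" using 0 that by auto
  have 1: "\<forall>A\<in>p. \<forall>B\<in>p. A \<inter> B \<in> p" using p by (elim conjE)
  have 2: "\<forall>A\<in>p. \<forall>B. A \<subseteq> B \<and> B \<subseteq> S \<longrightarrow> B \<in> p" using p by (elim conjE)
  have 3: "\<forall>A. A \<subseteq> S \<longrightarrow> A \<in> p \<or> S - A \<in> p" using p by (elim conjE)
  show "A \<inter> B \<in> p" if "A \<in> p" "B \<in> p" using 1 that by (elim ballE) auto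
  show "B \<in> p" if "A \<in> p" "A \<subseteq> B" "B \<subseteq> S" using 2[rule_format, OF that(1)] that by simp
  show "A \<in> p \<or> S - A \<in> p" if "A \<subseteq> S" using 3 that by simp
qed

lemma beta_Int_iff:
  assumes "p \<in> beta S" "A \<subseteq> S" "B \<subseteq> S"
  shows "A \<inter> B \<in> p \<longleftrightarrow> A \<in> p \<and> B \<in> p"
proof
  assume AB: "A \<inter> B \<in> p"
  show "A \<in> p \<and> B \<in> p"
    using beta_mono[OF assms(1) AB _ assms(2)] beta_mono[OF assms(1) AB _ assms(3)] by simp
qed (simp add: beta_Int[OF assms(1)])

lemma beta_Diff_iff:
  assumes "p \<in> beta S" "A \<subseteq> S"
  shows "S - A \<in> p \<longleftrightarrow> A \<notin> p"
proof
  assume "S - A \<in> p"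
  moreover have "{} \<notin> p" using beta_nonempty[OF assms(1)] by auto
  ultimately show "A \<notin> p" using beta_Int[OF assms(1), of A "S - A"] by auto
qed (use beta_cases[OF assms] in simp)

lemma beta_INT:
  assumes "p \<in> beta S" "finite F" "\<And>i. i \<in> F \<Longrightarrow> A i \<in> p"
  shows "S \<inter> (\<Inter>i\<in>F. A i) \<in> p"
  using assms(2,3)
proof (induction F rule: finite_induct)
  case empty
  then show ?case using assms(1) by (simp add: beta_space)
next
  case (insert i F)
  have "A i \<inter> (S \<inter> (\<Inter>i\<in>F. A i)) \<in> p"
    by (rule beta_Int[OF assms(1)]) (use insert in auto)
  then show ?case by (simp add: Int_left_commute)
qed

lemma beta_UN:
  assumes p: "p \<in> beta S" and F: "finite F" and A: "\<And>i. i \<in> F \<Longrightarrow> A i \<subseteq> S" and U: "(\<Union>i\<in>F. A i) \<in> p"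
  obtains i where "i \<in> F" "A i \<in> p"
proof -
  have "\<exists>i\<in>F. A i \<in> p"
  proof (rule ccontr)
    assume "\<not> ?thesis"
    then have "S \<inter> (\<Inter>i\<in>F. S - A i) \<in> p"
      using A by (intro beta_INT[OF p F]) (simp add: beta_Diff_iff[OF p])
    then have "(\<Union>i\<in>F. A i) \<inter> (S \<inter> (\<Inter>i\<in>F. S - A i)) \<in> p" by (rule beta_Int[OF p U])
    moreover have "(\<Union>i\<in>F. A i) \<inter> (S \<inter> (\<Inter>i\<in>F. S - A i)) = {}" by auto
    ultimately show False using beta_nonempty[OF p, of "{}"] by simp
  qed
  then obtain i where "i \<in> F" "A i \<in> p" by (rule bexE)
  then show thesis by (rule that)
qed

lemma beta_eqI:
  assumes p: "p \<in> beta S" and q: "q \<in> beta S" and "p \<subseteq> q"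
  shows "p = q"
proof
  show "q \<subseteq> p"
  proof
    fix A assume A: "A \<in> q"
    then have AS: "A \<subseteq> S" using beta_subset[OF q] by blast
    then have "S - A \<notin> p" using A assms(3) by (auto simp: beta_Diff_iff[OF q])
    then show "A \<in> p" by (simp add: beta_Diff_iff[OF p AS])
  qed
qed fact

lemma betaI:
  assumes "S \<in> p" "{} \<notin> p" "\<And>A. A \<in> p \<Longrightarrow> A \<subseteq> S" "\<And>A B. \<lbrakk>A \<in> p; B \<in> p\<rbrakk> \<Longrightarrow> A \<inter> B \<in> p"
    "\<And>A B. \<lbrakk>A \<in> p; A \<subseteq> B; B \<subseteq> S\<rbrakk> \<Longrightarrow> B \<in> p" "\<And>A. A \<subseteq> S \<Longrightarrow> A \<in> p \<or> S - A \<in> p"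
  shows "p \<in> beta S"
proof -
  have "\<forall>A\<in>p. \<forall>B\<in>p. A \<inter> B \<in> p" using assms(4) by simp
  moreover have "\<forall>A\<in>p. \<forall>B. A \<subseteq> B \<and> B \<subseteq> S \<longrightarrow> B \<in> p" using assms(5) by (intro ballI allI impI) simp
  moreover have "\<forall>A. A \<subseteq> S \<longrightarrow> A \<in> p \<or> S - A \<in> p" using assms(6) by simp
  moreover have "p \<subseteq> Pow S" by (rule subsetI, rule PowI, rule assms(3))
  ultimately show ?thesis using assms(1,2) unfolding beta_def mem_Collect_eq by (intro conjI)
qed

text \<open>Zorn's lemma on families with the finite intersection property. The extra
  \<open>S\<close> in each intersection lets the empty subfamily express that \<open>S\<close> is
  nonempty.\<close>

lemma ultrafilter_exists:
  assumes F: "\<F> \<subseteq> Pow S" and fip: "\<And>\<G>. \<lbrakk>finite \<G>; \<G> \<subseteq> \<F>\<rbrakk> \<Longrightarrow> S \<inter> \<Inter>\<G> \<noteq> {}"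
  obtains p where "p \<in> beta S" "\<F> \<subseteq> p"
proof -
  define \<A> where "\<A> = {\<H>. \<F> \<subseteq> \<H> \<and> \<H> \<subseteq> Pow S \<and> (\<forall>\<G>. finite \<G> \<and> \<G> \<subseteq> \<H> \<longrightarrow> S \<inter> \<Inter>\<G> \<noteq> {})}"
  have "\<exists>M\<in>\<A>. \<forall>X\<in>\<A>. M \<subseteq> X \<longrightarrow> X = M"
  proof (rule subset_Zorn_nonempty)
    have "\<F> \<in> \<A>" using F fip by (simp add: \<A>_def)
    then show "\<A> \<noteq> {}" by auto
  next
    fix \<C> assume ne: "\<C> \<noteq> {}" and ch: "subset.chain \<A> \<C>"
    have sub: "\<C> \<subseteq> \<A>" using ch by (simp add: subset_chain_def)
    have "S \<inter> \<Inter>\<G> \<noteq> {}" if G: "finite \<G>" "\<G> \<subseteq> \<Union>\<C>" for \<G>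
    proof -
      obtain \<H> where "\<H> \<in> \<C>" "\<G> \<subseteq> \<H>"
        by (rule finite_subset_Union_chain[OF G ne ch])
      moreover from this have "\<H> \<in> \<A>" using sub by auto
      ultimately show ?thesis using that(1) by (simp add: \<A>_def)
    qed
    moreover have sub': "\<F> \<subseteq> \<H>" "\<H> \<subseteq> Pow S" if "\<H> \<in> \<C>" for \<H>
      using that sub by (auto simp: \<A>_def)
    obtain \<H> where "\<H> \<in> \<C>" using ne by auto
    then have "\<F> \<subseteq> \<Union>\<C>" using sub'(1) by auto
    moreover have "\<Union>\<C> \<subseteq> Pow S" using sub'(2) by (rule Union_least)
    ultimately show "\<Union>\<C> \<in> \<A>" by (simp add: \<A>_def)
  qed
  then obtain p where p: "p \<in> \<A>" and max: "\<And>X. \<lbrakk>X \<in> \<A>; p \<subseteq> X\<rbrakk> \<Longrightarrow> X = p"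
    by (elim bexE) simp
  have pS: "p \<subseteq> Pow S" and Fp: "\<F> \<subseteq> p" and pfip: "\<And>\<G>. \<lbrakk>finite \<G>; \<G> \<subseteq> p\<rbrakk> \<Longrightarrow> S \<inter> \<Inter>\<G> \<noteq> {}"
    using p by (simp_all add: \<A>_def)
  \<comment> \<open>Maximality in usable form: a set meeting every finite intersection from
    \<open>p\<close> could be adjoined, so it already belongs. The closure laws of an ultrafilter
    all follow from this.\<close>
  have key: "A \<in> p" if A: "A \<subseteq> S" and meet: "\<And>\<G>. \<lbrakk>finite \<G>; \<G> \<subseteq> p\<rbrakk> \<Longrightarrow> A \<inter> \<Inter>\<G> \<noteq> {}" for A
  proof -
    have "S \<inter> \<Inter>\<G> \<noteq> {}" if G: "finite \<G>" "\<G> \<subseteq> insert A p" for \<G>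
    proof -
      have "A \<inter> \<Inter>(\<G> - {A}) \<noteq> {}" using G by (intro meet) auto
      then show ?thesis using A by auto
    qed
    moreover have "\<F> \<subseteq> insert A p" "insert A p \<subseteq> Pow S" using A pS Fp by auto
    ultimately have "insert A p \<in> \<A>" by (simp add: \<A>_def)
    then show ?thesis using max[of "insert A p"] by auto
  qed
  have "p \<in> beta S"
  proof (rule betaI)
    show "S \<in> p" using pfip by (intro key) auto
    show "{} \<notin> p" using pfip[of "{{}}"] by auto
    show "A \<subseteq> S" if "A \<in> p" for A using that pS by auto
    show "A \<inter> B \<in> p" if AB: "A \<in> p" "B \<in> p" for A B
    proof (rule key)
      show "A \<inter> B \<inter> \<Inter>\<G> \<noteq> {}" if "finite \<G>" "\<G> \<subseteq> p" for \<G>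
        using pfip[of "insert A (insert B \<G>)"] that AB by auto
    qed (use AB pS in auto)
    show "B \<in> p" if AB: "A \<in> p" "A \<subseteq> B" "B \<subseteq> S" for A B
    proof (rule key)
      show "B \<inter> \<Inter>\<G> \<noteq> {}" if "finite \<G>" "\<G> \<subseteq> p" for \<G>
        using pfip[of "insert A \<G>"] that AB by auto
    qed (use AB in auto)
    show "A \<in> p \<or> S - A \<in> p" if A: "A \<subseteq> S" for A
    proof (rule ccontr)
      assume neg: "\<not> ?thesis"
      \<comment> \<open>If neither \<open>A\<close> nor its complement belongs, each of them misses
        some finite intersection, and the two finite families together miss all of
        \<open>S\<close>.\<close>
      obtain \<G> where G: "finite \<G>" "\<G> \<subseteq> p" "A \<inter> \<Inter>\<G> = {}" using key[of A] neg A by blast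
      obtain \<H> where H: "finite \<H>" "\<H> \<subseteq> p" "(S - A) \<inter> \<Inter>\<H> = {}" using key[of "S - A"] neg by blast
      have "S \<inter> \<Inter>(\<G> \<union> \<H>) = {}" using G(3) H(3) A by auto
      then show False using pfip[of "\<G> \<union> \<H>"] G H by blast
    qed
  qed
  then show thesis using Fp that by blast
qed

section \<open>Neighborhoods and ultrafilters near a point\<close>

lemma neighborhoods_Int: "\<lbrakk>U \<in> neighborhoods x; V \<in> neighborhoods x\<rbrakk> \<Longrightarrow> U \<inter> V \<in> neighborhoods x"
  by (simp add: neighborhoods_def)

lemma neighborhoods_mono: "\<lbrakk>U \<in> neighborhoods x; U \<subseteq> V\<rbrakk> \<Longrightarrow> V \<in> neighborhoods x"
  using interior_mono[of U V] by (auto simp: neighborhoods_def)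

lemma open_in_neighborhoods: "\<lbrakk>open U; x \<in> U\<rbrakk> \<Longrightarrow> U \<in> neighborhoods x"
  by (simp add: neighborhoods_def interior_open)

lemma neighborhoods_UNIV: "UNIV \<in> neighborhoods x"
  by (simp add: neighborhoods_def)

lemma closure_iff_neighborhoods: "x \<in> closure A \<longleftrightarrow> (\<forall>U\<in>neighborhoods x. U \<inter> A \<noteq> {})"
proof
  assume "x \<in> closure A"
  then have "interior U \<inter> A \<noteq> {}" if "x \<in> interior U" for U
    using that by (auto simp: closure_iff_nhds_not_empty)
  then show "\<forall>U\<in>neighborhoods x. U \<inter> A \<noteq> {}"
    using interior_subset by (fastforce simp: neighborhoods_def)
next
  assume R: "\<forall>U\<in>neighborhoods x. U \<inter> A \<noteq> {}"
  then show "x \<in> closure A"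
    unfolding closure_iff_nhds_not_empty
  proof (intro allI impI)
    fix V U assume "U \<subseteq> V" "open U" "x \<in> U"
    then have "V \<in> neighborhoods x" by (blast intro: neighborhoods_mono open_in_neighborhoods)
    then show "A \<inter> V \<noteq> {}" using R by auto
  qed
qed

lemma near_ultrafilters_beta: "p \<in> near_ultrafilters e S \<Longrightarrow> p \<in> beta S"
  by (simp add: near_ultrafilters_def)

lemma near_ultrafilters_Int_neighborhood:
  "\<lbrakk>p \<in> near_ultrafilters e S; U \<in> neighborhoods e\<rbrakk> \<Longrightarrow> U \<inter> S \<in> p"
  by (simp add: near_ultrafilters_def)

text \<open>With the traces of all neighborhoods of \<open>e\<close> adjoined to the generators, the
  finite intersection property becomes a closure condition: a set meets every trace exactly when
  \<open>e\<close> adheres to its part in \<open>S\<close>. Ultrafilters near \<open>e\<close> with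
  prescribed members are later obtained from this criterion.\<close>

lemma near_ultrafilter_exists:
  assumes F: "\<F> \<subseteq> Pow S" and fip: "\<And>\<G>. \<lbrakk>finite \<G>; \<G> \<subseteq> \<F>\<rbrakk> \<Longrightarrow> e \<in> closure (S \<inter> \<Inter>\<G>)"
  obtains p where "p \<in> near_ultrafilters e S" "\<F> \<subseteq> p"
proof -
  obtain p where p: "p \<in> beta S" "\<F> \<union> (\<lambda>U. U \<inter> S) ` neighborhoods e \<subseteq> p"
  proof (rule ultrafilter_exists)
    fix \<G> assume G: "finite \<G>" "\<G> \<subseteq> \<F> \<union> (\<lambda>U. U \<inter> S) ` neighborhoods e"
    then have "finite (\<G> - \<F>)" "\<G> - \<F> \<subseteq> (\<lambda>U. U \<inter> S) ` neighborhoods e" by auto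
    from finite_subset_image[OF this] obtain \<H> where H: "\<H> \<subseteq> neighborhoods e" "finite \<H>"
        "\<G> - \<F> = (\<lambda>U. U \<inter> S) ` \<H>" by auto
    have "\<Inter>\<H> \<in> neighborhoods e" using H(2,1)
      by (induction \<H> rule: finite_induct) (simp_all add: neighborhoods_UNIV neighborhoods_Int)
    moreover have "e \<in> closure (S \<inter> \<Inter>(\<G> \<inter> \<F>))" using G by (intro fip) auto
    ultimately have "\<Inter>\<H> \<inter> (S \<inter> \<Inter>(\<G> \<inter> \<F>)) \<noteq> {}"
      by (simp add: closure_iff_neighborhoods)
    then obtain x where x: "x \<in> S" "\<And>U. U \<in> \<H> \<Longrightarrow> x \<in> U" "\<And>A. A \<in> \<G> \<inter> \<F> \<Longrightarrow> x \<in> A" by auto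
    have "x \<in> A" if "A \<in> \<G>" for A
    proof (cases "A \<in> \<F>")
      case False
      then have "A \<in> (\<lambda>U. U \<inter> S) ` \<H>" using that H(3) by blast
      then show ?thesis using x(1,2) by auto
    qed (use x(3) that in simp)
    then show "S \<inter> \<Inter>\<G> \<noteq> {}" using x(1) by auto
  qed (use F in auto)
  then show thesis using that by (auto simp: near_ultrafilters_def)
qed

lemma near_ultrafilter_containing:
  assumes "A \<subseteq> S" "e \<in> closure A"
  obtains p where "p \<in> near_ultrafilters e S" "A \<in> p"
proof -
  obtain p where "p \<in> near_ultrafilters e S" "{A} \<subseteq> p"
  proof (rule near_ultrafilter_exists)
    fix \<G> assume "finite \<G>" "\<G> \<subseteq> {A}"
    then have "A \<subseteq> S \<inter> \<Inter>\<G>" using assms(1) by auto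
    then show "e \<in> closure (S \<inter> \<Inter>\<G>)" using assms(2) closure_mono by blast
  qed (use assms in auto)
  then show thesis using that by auto
qed

lemma near_ultrafilter_closure:
  assumes "p \<in> near_ultrafilters e S" "A \<in> p"
  shows "e \<in> closure A"
  unfolding closure_iff_neighborhoods
proof
  fix U assume "U \<in> neighborhoods e"
  then have "U \<inter> S \<in> p" by (rule near_ultrafilters_Int_neighborhood[OF assms(1)])
  then have "U \<inter> S \<inter> A \<in> p" using assms(2) by (rule beta_Int[OF near_ultrafilters_beta[OF assms(1)]])
  then have "U \<inter> S \<inter> A \<noteq> {}" by (rule beta_nonempty[OF near_ultrafilters_beta[OF assms(1)]])
  then show "U \<inter> A \<noteq> {}" by auto
qed

text \<open>The topology inherited from the space of all ultrafilters, whose basic open sets consist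
  of the ultrafilters containing a given \<open>A\<close>; openness is stated pointwise through
  these basic neighborhoods.\<close>

definition near_ultrafilter_topology :: "'a::topological_space \<Rightarrow> 'a set \<Rightarrow> 'a set set topology" where
  "near_ultrafilter_topology e S = topology (\<lambda>U. U \<subseteq> near_ultrafilters e S \<and>
     (\<forall>p\<in>U. \<exists>A\<in>p. \<forall>q\<in>near_ultrafilters e S. A \<in> q \<longrightarrow> q \<in> U))"

lemma openin_near_ultrafilter_topology:
  "openin (near_ultrafilter_topology e S) U \<longleftrightarrow> U \<subseteq> near_ultrafilters e S \<and>
     (\<forall>p\<in>U. \<exists>A\<in>p. \<forall>q\<in>near_ultrafilters e S. A \<in> q \<longrightarrow> q \<in> U)"
proof -
  let ?O = "\<lambda>U. U \<subseteq> near_ultrafilters e S \<and>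
     (\<forall>p\<in>U. \<exists>A\<in>p. \<forall>q\<in>near_ultrafilters e S. A \<in> q \<longrightarrow> q \<in> U)"
  have "istopology ?O"
    unfolding istopology_def
  proof (intro conjI allI impI)
    fix U V assume U: "?O U" and V: "?O V"
    show "U \<inter> V \<subseteq> near_ultrafilters e S" using U by blast
    show "\<forall>p\<in>U \<inter> V. \<exists>A\<in>p. \<forall>q\<in>near_ultrafilters e S. A \<in> q \<longrightarrow> q \<in> U \<inter> V"
    proof
      fix p assume p: "p \<in> U \<inter> V"
      then have "p \<in> near_ultrafilters e S" using U by auto
      then have pb: "p \<in> beta S" by (rule near_ultrafilters_beta)
      obtain A where A: "A \<in> p" "\<forall>q\<in>near_ultrafilters e S. A \<in> q \<longrightarrow> q \<in> U" using U p by auto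
      obtain B where B: "B \<in> p" "\<forall>q\<in>near_ultrafilters e S. B \<in> q \<longrightarrow> q \<in> V" using V p by auto
      show "\<exists>A\<in>p. \<forall>q\<in>near_ultrafilters e S. A \<in> q \<longrightarrow> q \<in> U \<inter> V"
      proof (intro bexI[of _ "A \<inter> B"] ballI impI)
        show "A \<inter> B \<in> p" by (rule beta_Int[OF pb A(1) B(1)])
        fix q assume q: "q \<in> near_ultrafilters e S" "A \<inter> B \<in> q"
        then have "A \<in> q" "B \<in> q"
          using beta_Int_iff[OF near_ultrafilters_beta beta_subset beta_subset, OF q(1) pb A(1) pb B(1)] by auto
        then show "q \<in> U \<inter> V" using A(2) B(2) q(1) by simp
      qed
    qed
  next
    fix \<U> assume O: "\<forall>U\<in>\<U>. ?O U"
    then show "\<Union>\<U> \<subseteq> near_ultrafilters e S" by (intro Union_least) simp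
    show "\<forall>p\<in>\<Union>\<U>. \<exists>A\<in>p. \<forall>q\<in>near_ultrafilters e S. A \<in> q \<longrightarrow> q \<in> \<Union>\<U>"
    proof
      fix p assume "p \<in> \<Union>\<U>"
      then obtain U where U: "U \<in> \<U>" "p \<in> U" by (rule UnionE)
      have "\<forall>p\<in>U. \<exists>A\<in>p. \<forall>q\<in>near_ultrafilters e S. A \<in> q \<longrightarrow> q \<in> U" using O U(1) by simp
      then obtain A where "A \<in> p" "\<forall>q\<in>near_ultrafilters e S. A \<in> q \<longrightarrow> q \<in> U" using U(2) by auto
      then show "\<exists>A\<in>p. \<forall>q\<in>near_ultrafilters e S. A \<in> q \<longrightarrow> q \<in> \<Union>\<U>" using U(1) by auto
    qed
  qed
  then show ?thesis by (simp add: near_ultrafilter_topology_def)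
qed

lemma topspace_near_ultrafilter_topology [simp]:
  "topspace (near_ultrafilter_topology e S) = near_ultrafilters e S"
proof -
  have "openin (near_ultrafilter_topology e S) (near_ultrafilters e S)"
    unfolding openin_near_ultrafilter_topology
    by (auto intro!: bexI[of _ S] beta_space near_ultrafilters_beta)
  then have "near_ultrafilters e S \<subseteq> topspace (near_ultrafilter_topology e S)" by (rule openin_subset)
  moreover have "topspace (near_ultrafilter_topology e S) \<subseteq> near_ultrafilters e S"
    using openin_topspace[of "near_ultrafilter_topology e S"]
    unfolding openin_near_ultrafilter_topology[of _ _ "topspace _"] by (rule conjunct1)
  ultimately show ?thesis by (intro equalityI)
qed

lemma openin_near_ultrafilters_containing:
  "openin (near_ultrafilter_topology e S) {p \<in> near_ultrafilters e S. A \<in> p}"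
  unfolding openin_near_ultrafilter_topology by (auto intro: bexI[of _ A])

lemma closedin_near_ultrafilters_containing:
  assumes "A \<subseteq> S"
  shows "closedin (near_ultrafilter_topology e S) {p \<in> near_ultrafilters e S. A \<in> p}"
proof -
  have "near_ultrafilters e S - {p \<in> near_ultrafilters e S. A \<in> p} = {p \<in> near_ultrafilters e S. S - A \<in> p}"
    using beta_Diff_iff[OF near_ultrafilters_beta assms] by auto
  then show ?thesis
    using openin_near_ultrafilters_containing[of e S "S - A"] by (auto simp: closedin_def)
qed

lemma Hausdorff_near_ultrafilter_topology: "Hausdorff_space (near_ultrafilter_topology e S)"
  unfolding Hausdorff_space_def topspace_near_ultrafilter_topology
proof clarify
  fix p q assume p: "p \<in> near_ultrafilters e S" and q: "q \<in> near_ultrafilters e S" and "p \<noteq> q"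
  then obtain A where A: "A \<in> p" "A \<notin> q"
    using beta_eqI[OF near_ultrafilters_beta[OF p] near_ultrafilters_beta[OF q]] by auto
  have AS: "A \<subseteq> S" by (rule beta_subset[OF near_ultrafilters_beta[OF p] A(1)])
  let ?U = "\<lambda>A. {r \<in> near_ultrafilters e S. A \<in> r}"
  have "p \<in> ?U A" "q \<in> ?U (S - A)"
    using p q A AS beta_Diff_iff[OF near_ultrafilters_beta[OF q]] by auto
  moreover have "disjnt (?U A) (?U (S - A))"
    using beta_Diff_iff[OF near_ultrafilters_beta AS] by (auto simp: disjnt_def)
  ultimately show "\<exists>U V. openin (near_ultrafilter_topology e S) U \<and>
      openin (near_ultrafilter_topology e S) V \<and> p \<in> U \<and> q \<in> V \<and> disjnt U V"
    by (intro exI[of _ "?U A"] exI[of _ "?U (S - A)"] conjI openin_near_ultrafilters_containing)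
qed

lemma compact_near_ultrafilter_topology: "compact_space (near_ultrafilter_topology e S)"
  unfolding compact_space_fip
proof (intro allI impI, elim conjE)
  fix \<U> assume cl: "\<forall>C\<in>\<U>. closedin (near_ultrafilter_topology e S) C"
    and fip: "\<forall>\<F>. finite \<F> \<and> \<F> \<subseteq> \<U> \<longrightarrow> \<Inter>\<F> \<noteq> {}"
  \<comment> \<open>These are the sets forced on all members of one of the given closed sets. An
    ultrafilter \<open>p\<close> extending \<open>\<H>\<close> cannot avoid any \<open>C\<close>: a
    basic neighborhood \<open>A\<close> of \<open>p\<close> missing \<open>C\<close> would put
    \<open>S - A\<close> into \<open>\<H>\<close>.\<close>
  define \<H> where "\<H> = {A. A \<subseteq> S \<and> (\<exists>C\<in>\<U>. \<forall>p\<in>C. A \<in> p)}"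
  have CX: "C \<subseteq> near_ultrafilters e S" if "C \<in> \<U>" for C
    using cl that closedin_subset by fastforce
  show "\<Inter>\<U> \<noteq> {}"
  proof (cases "\<U> = {}")
    case False
    then obtain C0 where C0: "C0 \<in> \<U>" by blast
    obtain p where p: "p \<in> near_ultrafilters e S" "\<H> \<subseteq> p"
    proof (rule near_ultrafilter_exists)
      show "\<H> \<subseteq> Pow S" by (auto simp: \<H>_def)
      fix \<G> assume G: "finite \<G>" "\<G> \<subseteq> \<H>"
      then have "\<forall>A\<in>\<G>. \<exists>C\<in>\<U>. \<forall>p\<in>C. A \<in> p" by (auto simp: \<H>_def)
      then obtain c where c: "\<And>A. A \<in> \<G> \<Longrightarrow> c A \<in> \<U>" "\<And>A p. \<lbrakk>A \<in> \<G>; p \<in> c A\<rbrakk> \<Longrightarrow> A \<in> p" by metis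
      \<comment> \<open>Inserting \<open>C0\<close> provides an ultrafilter \<open>q\<close> even
        when \<open>\<G>\<close> is empty.\<close>
      have "\<Inter>(insert C0 (c ` \<G>)) \<noteq> {}" using fip[rule_format, of "insert C0 (c ` \<G>)"] G C0 c by auto
      then obtain q where q: "q \<in> C0" "\<And>A. A \<in> \<G> \<Longrightarrow> q \<in> c A" by auto
      have qX: "q \<in> near_ultrafilters e S" using q(1) CX[OF C0] by blast
      have "S \<inter> (\<Inter>A\<in>\<G>. A) \<in> q"
        by (rule beta_INT[OF near_ultrafilters_beta[OF qX] G(1)]) (rule c(2)[OF _ q(2)])
      then show "e \<in> closure (S \<inter> \<Inter>\<G>)" using near_ultrafilter_closure[OF qX] by simp
    qed
    have "p \<in> C" if C: "C \<in> \<U>" for C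
    proof (rule ccontr)
      assume "p \<notin> C"
      then have "p \<in> near_ultrafilters e S - C" using p(1) by simp
      moreover have "openin (near_ultrafilter_topology e S) (near_ultrafilters e S - C)"
        using cl C by (auto simp: closedin_def)
      ultimately have "\<exists>A\<in>p. \<forall>q\<in>near_ultrafilters e S. A \<in> q \<longrightarrow> q \<in> near_ultrafilters e S - C"
        unfolding openin_near_ultrafilter_topology by (elim conjE) (rule bspec)
      then obtain A where A: "A \<in> p" "\<And>q. \<lbrakk>q \<in> near_ultrafilters e S; A \<in> q\<rbrakk> \<Longrightarrow> q \<notin> C"
        by (elim bexE) simp
      have AS: "A \<subseteq> S" by (rule beta_subset[OF near_ultrafilters_beta[OF p(1)] A(1)])
      have "S - A \<in> q" if "q \<in> C" for q
      proof -
        have q: "q \<in> near_ultrafilters e S" using that CX[OF C] by auto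
        then have "A \<notin> q" using that A(2) by auto
        then show ?thesis by (simp add: beta_Diff_iff[OF near_ultrafilters_beta[OF q] AS])
      qed
      then have "S - A \<in> \<H>" unfolding \<H>_def using C by (intro CollectI conjI Diff_subset bexI[of _ C] ballI)
      then have "S - A \<in> p" by (rule subsetD[OF p(2)])
      then show False using A(1) by (simp add: beta_Diff_iff[OF near_ultrafilters_beta[OF p(1)] AS])
    qed
    then show ?thesis by auto
  qed simp
qed

section \<open>The semigroup of ultrafilters near an idempotent\<close>

lemma beta_plus_iff: "A \<in> beta_plus S p q \<longleftrightarrow> A \<subseteq> S \<and> {s \<in> S. shift S s A \<in> q} \<in> p"
  by (simp add: beta_plus_def)

lemma shift_subset: "shift S s A \<subseteq> S"
  by (auto simp: shift_def)

lemma beta_plus_beta: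
  fixes S :: "'a::semigroup_add set"
  assumes S: "\<And>x y. \<lbrakk>x \<in> S; y \<in> S\<rbrakk> \<Longrightarrow> x + y \<in> S" and p: "p \<in> beta S" and q: "q \<in> beta S"
  shows "beta_plus S p q \<in> beta S"
proof (rule betaI)
  have shS: "shift S s S = S" if "s \<in> S" for s using S that by (auto simp: shift_def)
  then have "{s \<in> S. shift S s S \<in> q} = S" using beta_space[OF q] by auto
  then show "S \<in> beta_plus S p q" using beta_space[OF p] by (simp add: beta_plus_iff)
  have "{s \<in> S. shift S s {} \<in> q} = {}" using beta_nonempty[OF q] by (auto simp: shift_def)
  then show "{} \<notin> beta_plus S p q" using beta_nonempty[OF p] by (auto simp: beta_plus_iff)
  show "A \<inter> B \<in> beta_plus S p q" if "A \<in> beta_plus S p q" "B \<in> beta_plus S p q" for A B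
  proof -
    have "shift S s (A \<inter> B) = shift S s A \<inter> shift S s B" for s by (auto simp: shift_def)
    then have "{s \<in> S. shift S s (A \<inter> B) \<in> q} = {s \<in> S. shift S s A \<in> q} \<inter> {s \<in> S. shift S s B \<in> q}"
      using beta_Int_iff[OF q shift_subset shift_subset] by auto
    then show ?thesis using that beta_Int[OF p] by (auto simp: beta_plus_iff)
  qed
  show "B \<in> beta_plus S p q" if "A \<in> beta_plus S p q" "A \<subseteq> B" "B \<subseteq> S" for A B
  proof -
    have "shift S s A \<subseteq> shift S s B" for s using that by (auto simp: shift_def)
    then have "{s \<in> S. shift S s A \<in> q} \<subseteq> {s \<in> S. shift S s B \<in> q}"
      using beta_mono[OF q _ _ shift_subset] by auto
    moreover have "{s \<in> S. shift S s A \<in> q} \<in> p" using that(1) by (simp add: beta_plus_iff)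
    ultimately show ?thesis using that(3) beta_mono[OF p] by (auto simp: beta_plus_iff)
  qed
  show "A \<in> beta_plus S p q \<or> S - A \<in> beta_plus S p q" if A: "A \<subseteq> S" for A
  proof -
    have "shift S s (S - A) = S - shift S s A" if "s \<in> S" for s using S that by (auto simp: shift_def)
    then have "{s \<in> S. shift S s (S - A) \<in> q} = S - {s \<in> S. shift S s A \<in> q}"
      using beta_Diff_iff[OF q shift_subset] by auto
    then show ?thesis using A beta_Diff_iff[OF p, of "{s \<in> S. shift S s A \<in> q}"]
      by (auto simp: beta_plus_iff)
  qed
qed (simp add: beta_plus_iff)

text \<open>Unfolding membership on both sides leaves the identity
  \<open>-t + (-s + A) = -(s + t) + A\<close>, so the equation holds for arbitrary families of sets
  \<open>p\<close>, \<open>q\<close>, \<open>r\<close>.\<close>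

lemma beta_plus_assoc:
  fixes S :: "'a::semigroup_add set"
  assumes S: "\<And>x y. \<lbrakk>x \<in> S; y \<in> S\<rbrakk> \<Longrightarrow> x + y \<in> S"
  shows "beta_plus S (beta_plus S p q) r = beta_plus S p (beta_plus S q r)"
proof (rule set_eqI)
  fix A
  have "{t \<in> S. shift S t (shift S s A) \<in> r} = shift S s {t \<in> S. shift S t A \<in> r}" if s: "s \<in> S" for s
  proof -
    have "shift S t (shift S s A) = shift S (s + t) A" if "t \<in> S" for t
      using S s that by (auto simp: shift_def add.assoc)
    then show ?thesis using S s by (auto simp: shift_def[of S s "{t \<in> S. shift S t A \<in> r}"])
  qed
  then have "{s \<in> S. shift S s {t \<in> S. shift S t A \<in> r} \<in> q} =
      {s \<in> S. {t \<in> S. shift S t (shift S s A) \<in> r} \<in> q}" by auto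
  then show "A \<in> beta_plus S (beta_plus S p q) r \<longleftrightarrow> A \<in> beta_plus S p (beta_plus S q r)"
    by (auto simp: beta_plus_iff shift_subset)
qed

lemma near_subsemigroupD:
  assumes "near_subsemigroup e S"
  shows "S \<noteq> {}" "\<And>x y. \<lbrakk>x \<in> S; y \<in> S\<rbrakk> \<Longrightarrow> x + y \<in> S" "e + e = e" "e \<notin> S" "e \<in> closure S"
  using assms unfolding near_subsemigroup_def by auto

text \<open>Addition is only separately continuous, so the neighborhood for the second summand
  depends on the first. Continuity of \<open>s + e\<close> in \<open>s\<close> produces
  \<open>V\<close>; afterwards each \<open>s\<close> in \<open>V\<close> receives its own
  neighborhood. This is the order of quantifiers in \<open>beta_plus\<close>.\<close>

lemma neighborhoods_translate:
  fixes e :: "'a::semitopological_semigroup_add"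
  assumes e: "e + e = e" and U: "U \<in> neighborhoods e"
  obtains V where "V \<in> neighborhoods e" "\<And>s. s \<in> V \<Longrightarrow> (\<lambda>t. s + t) -` U \<in> neighborhoods e"
proof
  let ?O = "interior U"
  have O: "open ?O" "e \<in> ?O" using U by (auto simp: neighborhoods_def)
  show "(\<lambda>s. s + e) -` ?O \<in> neighborhoods e"
    using O e by (intro open_in_neighborhoods open_vimage_right_translation) auto
  fix s assume "s \<in> (\<lambda>s. s + e) -` ?O"
  then have "(\<lambda>t. s + t) -` ?O \<in> neighborhoods e"
    using O by (intro open_in_neighborhoods open_vimage_left_translation) auto
  then show "(\<lambda>t. s + t) -` U \<in> neighborhoods e"
    by (rule neighborhoods_mono) (use interior_subset in auto)
qed

lemma beta_plus_near_ultrafilters: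
  assumes S: "near_subsemigroup e S" and p: "p \<in> near_ultrafilters e S" and q: "q \<in> near_ultrafilters e S"
  shows "beta_plus S p q \<in> near_ultrafilters e S"
  unfolding near_ultrafilters_def
proof (intro CollectI conjI ballI)
  note pb = near_ultrafilters_beta[OF p] and qb = near_ultrafilters_beta[OF q]
  show "beta_plus S p q \<in> beta S" using near_subsemigroupD(2)[OF S] pb qb by (rule beta_plus_beta)
  fix U assume "U \<in> neighborhoods e"
  then obtain V where V: "V \<in> neighborhoods e" "\<And>s. s \<in> V \<Longrightarrow> (\<lambda>t. s + t) -` U \<in> neighborhoods e"
    using neighborhoods_translate[OF near_subsemigroupD(3)[OF S]] by metis
  have "shift S s (U \<inter> S) \<in> q" if "s \<in> V" "s \<in> S" for s
  proof (rule beta_mono[OF qb])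
    show "(\<lambda>t. s + t) -` U \<inter> S \<in> q" by (rule near_ultrafilters_Int_neighborhood[OF q V(2)[OF that(1)]])
  qed (use that near_subsemigroupD(2)[OF S] in \<open>auto simp: shift_def\<close>)
  then have "{s \<in> S. shift S s (U \<inter> S) \<in> q} \<in> p"
    by (intro beta_mono[OF pb near_ultrafilters_Int_neighborhood[OF p V(1)]]) auto
  then show "U \<inter> S \<in> beta_plus S p q" by (simp add: beta_plus_iff)
qed

lemma compact_right_topological_semigroup_near_ultrafilters:
  assumes S: "near_subsemigroup e S"
  shows "compact_right_topological_semigroup (near_ultrafilter_topology e S) (beta_plus S)"
proof
  show "compact_space (near_ultrafilter_topology e S)" by (rule compact_near_ultrafilter_topology)
  show "Hausdorff_space (near_ultrafilter_topology e S)" by (rule Hausdorff_near_ultrafilter_topology)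
  show "topspace (near_ultrafilter_topology e S) \<noteq> {}"
    using near_ultrafilter_containing[OF order_refl near_subsemigroupD(5)[OF S]] by auto
  show "beta_plus S (beta_plus S p q) r = beta_plus S p (beta_plus S q r)" for p q r
    using near_subsemigroupD(2)[OF S] by (rule beta_plus_assoc)
  show "beta_plus S p q \<in> topspace (near_ultrafilter_topology e S)"
    if "p \<in> topspace (near_ultrafilter_topology e S)" "q \<in> topspace (near_ultrafilter_topology e S)" for p q
    using that beta_plus_near_ultrafilters[OF S] by simp
  fix q assume "q \<in> topspace (near_ultrafilter_topology e S)"
  then have q: "q \<in> near_ultrafilters e S" by simp
  show "continuous_map (near_ultrafilter_topology e S) (near_ultrafilter_topology e S) (\<lambda>p. beta_plus S p q)"
    unfolding continuous_map_def
  proof (intro conjI allI impI)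
    fix U assume U: "openin (near_ultrafilter_topology e S) U"
    show "openin (near_ultrafilter_topology e S)
      {p \<in> topspace (near_ultrafilter_topology e S). beta_plus S p q \<in> U}"
      unfolding openin_near_ultrafilter_topology topspace_near_ultrafilter_topology
    proof (intro conjI ballI)
      fix p assume "p \<in> {p \<in> near_ultrafilters e S. beta_plus S p q \<in> U}"
      then obtain A where A: "A \<in> beta_plus S p q" "\<And>r. \<lbrakk>r \<in> near_ultrafilters e S; A \<in> r\<rbrakk> \<Longrightarrow> r \<in> U"
        using U unfolding openin_near_ultrafilter_topology by auto
      show "\<exists>A\<in>p. \<forall>r\<in>near_ultrafilters e S. A \<in> r \<longrightarrow> r \<in> {p \<in> near_ultrafilters e S. beta_plus S p q \<in> U}"
      \<comment> \<open>The basic open set of \<open>A\<close> pulls back to the basic open set of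
        \<open>{s \<in> S. shift S s A \<in> q}\<close>. That set depends on \<open>q\<close> alone,
        which is why the sum is continuous in its left argument.\<close>
      proof (intro bexI[of _ "{s \<in> S. shift S s A \<in> q}"] ballI impI CollectI conjI)
        fix r assume "r \<in> near_ultrafilters e S" "{s \<in> S. shift S s A \<in> q} \<in> r"
        then show "beta_plus S r q \<in> U"
          using A beta_plus_near_ultrafilters[OF S _ q] by (auto simp: beta_plus_iff)
      qed (use A in \<open>auto simp: beta_plus_iff\<close>)
    qed auto
  qed (use beta_plus_near_ultrafilters[OF S _ q] in auto)
qed

lemmas near_semigroup_ideal_smallest_ideal =
  compact_right_topological_semigroup.semigroup_ideal_smallest_ideal
    [OF compact_right_topological_semigroup_near_ultrafilters, unfolded topspace_near_ultrafilter_topology]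
lemmas near_smallest_ideal_left_inverse =
  compact_right_topological_semigroup.smallest_ideal_left_inverse
    [OF compact_right_topological_semigroup_near_ultrafilters, unfolded topspace_near_ultrafilter_topology]
lemmas near_smallest_ideal_right_identity =
  compact_right_topological_semigroup.smallest_ideal_right_identity
    [OF compact_right_topological_semigroup_near_ultrafilters, unfolded topspace_near_ultrafilter_topology]
lemmas near_smallest_ideal_idempotent_below =
  compact_right_topological_semigroup.smallest_ideal_idempotent_below
    [OF compact_right_topological_semigroup_near_ultrafilters, unfolded topspace_near_ultrafilter_topology]
lemmas near_smallest_ideal_idempotent_minimal =
  compact_right_topological_semigroup.smallest_ideal_idempotent_minimal
    [OF compact_right_topological_semigroup_near_ultrafilters, unfolded topspace_near_ultrafilter_topology]
lemmas near_smallest_ideal_subset =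
  compact_right_topological_semigroup.smallest_ideal_subset
    [OF compact_right_topological_semigroup_near_ultrafilters, unfolded topspace_near_ultrafilter_topology]

section \<open>Images of ultrafilters under homomorphisms\<close>

text \<open>The image ultrafilter, that is, the value at \<open>p\<close> of the extension of
  \<open>f\<close> to ultrafilters. Both carriers are arguments because members of an ultrafilter
  are subsets of its carrier.\<close>

definition pushforward :: "('a \<Rightarrow> 'b) \<Rightarrow> 'a set \<Rightarrow> 'b set \<Rightarrow> 'a set set \<Rightarrow> 'b set set" where
  "pushforward f S S' p = {A. A \<subseteq> S' \<and> {s\<in>S. f s \<in> A} \<in> p}"

lemma pushforward_iff: "A \<in> pushforward f S S' p \<longleftrightarrow> A \<subseteq> S' \<and> {s\<in>S. f s \<in> A} \<in> p"
  by (simp add: pushforward_def)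

lemma pushforward_beta:
  assumes p: "p \<in> beta S" and f: "\<And>x. x \<in> S \<Longrightarrow> f x \<in> S'"
  shows "pushforward f S S' p \<in> beta S'"
proof (rule betaI)
  have "{s\<in>S. f s \<in> S'} = S" using f by auto
  then show "S' \<in> pushforward f S S' p" using beta_space[OF p] by (simp add: pushforward_iff)
  show "{} \<notin> pushforward f S S' p" using beta_nonempty[OF p, of "{}"] by (auto simp: pushforward_iff)
  show "A \<subseteq> S'" if "A \<in> pushforward f S S' p" for A using that by (simp add: pushforward_iff)
  show "A \<inter> B \<in> pushforward f S S' p" if "A \<in> pushforward f S S' p" "B \<in> pushforward f S S' p" for A B
  proof -
    have "{s\<in>S. f s \<in> A \<inter> B} = {s\<in>S. f s \<in> A} \<inter> {s\<in>S. f s \<in> B}" by auto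
    then show ?thesis using that beta_Int[OF p] by (auto simp: pushforward_iff)
  qed
  show "B \<in> pushforward f S S' p" if "A \<in> pushforward f S S' p" "A \<subseteq> B" "B \<subseteq> S'" for A B
  proof -
    have "{s\<in>S. f s \<in> A} \<in> p" using that(1) by (simp add: pushforward_iff)
    then have "{s\<in>S. f s \<in> B} \<in> p" by (rule beta_mono[OF p]) (use that(2) in auto)
    then show ?thesis using that(3) by (simp add: pushforward_iff)
  qed
  show "A \<in> pushforward f S S' p \<or> S' - A \<in> pushforward f S S' p" if "A \<subseteq> S'" for A
  proof -
    have "{s\<in>S. f s \<in> S' - A} = S - {s\<in>S. f s \<in> A}" using f by auto
    then show ?thesis using that beta_Diff_iff[OF p, of "{s\<in>S. f s \<in> A}"] by (auto simp: pushforward_iff)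
  qed
qed

text \<open>Continuity is asked for at \<open>e\<close> alone, since convergence to \<open>e\<close>
  is all that defines an ultrafilter near \<open>e\<close>.\<close>

locale near_homomorphism =
  fixes e :: "'a::semitopological_semigroup_add" and S :: "'a set"
    and e' :: "'b::semitopological_semigroup_add" and S' :: "'b set" and f :: "'a \<Rightarrow> 'b"
  assumes source: "near_subsemigroup e S" and target: "near_subsemigroup e' S'"
    and maps: "x \<in> S \<Longrightarrow> f x \<in> S'"
    and add: "\<lbrakk>x \<in> S; y \<in> S\<rbrakk> \<Longrightarrow> f (x + y) = f x + f y"
    and continuous_at: "U \<in> neighborhoods e' \<Longrightarrow> f -` U \<in> neighborhoods e"
begin

abbreviation "push \<equiv> pushforward f S S'"

lemma push_near_ultrafilters:
  assumes p: "p \<in> near_ultrafilters e S"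
  shows "push p \<in> near_ultrafilters e' S'"
  unfolding near_ultrafilters_def
proof (intro CollectI conjI ballI)
  note pb = near_ultrafilters_beta[OF p]
  show "push p \<in> beta S'" using pb maps by (rule pushforward_beta)
  fix U assume "U \<in> neighborhoods e'"
  then have "f -` U \<inter> S \<in> p" using p continuous_at by (simp add: near_ultrafilters_Int_neighborhood)
  also have "f -` U \<inter> S = {s\<in>S. f s \<in> U \<inter> S'}" using maps by auto
  finally show "U \<inter> S' \<in> push p" by (simp add: pushforward_iff)
qed

text \<open>For \<open>s\<close> and \<open>t\<close> in \<open>S\<close>, the point
  \<open>f t\<close> lies in \<open>-f s + A\<close> exactly when \<open>t\<close> lies in
  \<open>-s\<close> plus the preimage of \<open>A\<close>.\<close>

lemma push_plus: "push (beta_plus S p q) = beta_plus S' (push p) (push q)"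
proof (rule set_eqI)
  fix A
  note closed = near_subsemigroupD(2)[OF source]
  have "{t\<in>S. f t \<in> shift S' (f s) A} = shift S s {t\<in>S. f t \<in> A}" if "s \<in> S" for s
    using that maps add closed by (auto simp: shift_def)
  then have "{s\<in>S. f s \<in> {s'\<in>S'. shift S' s' A \<in> push q}} = {s\<in>S. shift S s {t\<in>S. f t \<in> A} \<in> q}"
    using maps by (auto simp: pushforward_iff shift_subset)
  moreover have "{s\<in>S. f s \<in> A} \<subseteq> S" by auto
  ultimately show "A \<in> push (beta_plus S p q) \<longleftrightarrow> A \<in> beta_plus S' (push p) (push q)"
    by (auto simp: beta_plus_iff pushforward_iff)
qed

text \<open>The closure condition lets the preimages of the members of \<open>r\<close> generate an
  ultrafilter near \<open>e\<close>. The resulting \<open>r \<subseteq> push p\<close> is an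
  equality because ultrafilters are maximal.\<close>

lemma push_surj:
  assumes r: "r \<in> near_ultrafilters e' S'" and cl: "\<And>A. A \<in> r \<Longrightarrow> e \<in> closure {s\<in>S. f s \<in> A}"
  obtains p where "p \<in> near_ultrafilters e S" "push p = r"
proof -
  note rb = near_ultrafilters_beta[OF r]
  obtain p where p: "p \<in> near_ultrafilters e S" "(\<lambda>A. {s\<in>S. f s \<in> A}) ` r \<subseteq> p"
  proof (rule near_ultrafilter_exists)
    fix \<G> assume "finite \<G>" "\<G> \<subseteq> (\<lambda>A. {s\<in>S. f s \<in> A}) ` r"
    from finite_subset_image[OF this] obtain \<H>
      where H: "\<H> \<subseteq> r" "finite \<H>" "\<G> = (\<lambda>A. {s\<in>S. f s \<in> A}) ` \<H>" by auto
    have "S' \<inter> (\<Inter>A\<in>\<H>. A) \<in> r" using rb H(2) by (rule beta_INT) (use H(1) in auto)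
    then have "e \<in> closure {s\<in>S. f s \<in> S' \<inter> (\<Inter>A\<in>\<H>. A)}" by (rule cl)
    moreover have "{s\<in>S. f s \<in> S' \<inter> (\<Inter>A\<in>\<H>. A)} \<subseteq> S \<inter> \<Inter>\<G>" using H(3) by auto
    ultimately show "e \<in> closure (S \<inter> \<Inter>\<G>)" by (rule rev_subsetD[OF _ closure_mono])
  qed auto
  have "r \<subseteq> push p"
  proof
    fix A assume A: "A \<in> r"
    then have "{s\<in>S. f s \<in> A} \<in> p" using p(2) by auto
    then show "A \<in> push p" using beta_subset[OF rb A] by (simp add: pushforward_iff)
  qed
  then have "r = push p"
    by (rule beta_eqI[OF rb near_ultrafilters_beta[OF push_near_ultrafilters[OF p(1)]]])
  then show thesis using p(1) that by simp
qed

end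

section \<open>Piecewise syndetic sets and the smallest ideal\<close>

lemma decreasing_local_baseD:
  assumes "decreasing_local_base e W"
  shows "W n \<in> neighborhoods e" "n \<le> m \<Longrightarrow> W m \<subseteq> W n" "U \<in> neighborhoods e \<Longrightarrow> \<exists>n. W n \<subseteq> U"
proof -
  show "W n \<in> neighborhoods e" "U \<in> neighborhoods e \<Longrightarrow> \<exists>n. W n \<subseteq> U"
    using assms by (simp_all add: decreasing_local_base_def)
  show "W m \<subseteq> W n" if "n \<le> m"
    by (rule lift_Suc_antimono_le[OF _ that]) (use assms in \<open>simp add: decreasing_local_base_def\<close>)
qed

lemma decreasing_local_base_avoids:
  assumes "decreasing_local_base e W" "(g::'a::semitopological_semigroup_add) \<noteq> e"
  obtains n where "\<forall>m\<ge>n. g \<notin> W m"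
proof -
  have "- {g} \<in> neighborhoods e" using assms(2) by (intro open_in_neighborhoods) auto
  from decreasing_local_baseD(3)[OF assms(1) this] obtain n where n: "W n \<subseteq> - {g}" ..
  have "\<forall>m\<ge>n. g \<notin> W m"
    using decreasing_local_baseD(2)[OF assms(1)] n by (intro allI impI) auto
  then show thesis by (rule that)
qed

lemma piecewise_syndetic_near_imp_smallest_ideal:
  assumes S: "near_subsemigroup e S" and ps: "piecewise_syndetic_near e S A"
  obtains p where "p \<in> smallest_ideal (beta_plus S) (near_ultrafilters e S)" "A \<in> p"
proof -
  let ?X = "near_ultrafilters e S"
  let ?K = "smallest_ideal (beta_plus S) ?X"
  obtain W where W: "decreasing_local_base e W" and ps': "piecewise_syndetic_near_wrt W e S A"
    using ps by (auto simp: piecewise_syndetic_near_def)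
  have AS: "A \<subseteq> S" using ps' unfolding piecewise_syndetic_near_wrt_def by (rule conjunct1)
  from ps' obtain F V where F: "\<forall>n. finite (F n) \<and> F n \<noteq> {} \<and> F n \<subseteq> W n \<inter> S"
    and V: "\<forall>n. V n \<in> neighborhoods e \<and> V n \<subseteq> W n"
    and FV: "\<forall>G U. finite G \<and> G \<noteq> {} \<and> G \<subseteq> S \<and> U \<in> neighborhoods e \<longrightarrow>
               (\<exists>x \<in> U \<inter> S. \<forall>n. (\<lambda>g. g + x) ` (G \<inter> V n) \<subseteq> (\<Union>t \<in> F n. shift S t A))"
    unfolding piecewise_syndetic_near_wrt_def by (elim conjE exE)
  define M where "M n = (\<Union>t \<in> F n. shift S t A)" for n
  \<comment> \<open>\<open>D g\<close> collects the \<open>x\<close> that serve \<open>g\<close> at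
    all levels \<open>n\<close> simultaneously, so that the finite sets \<open>G\<close> of the
    definition become finite intersections of sets \<open>D g\<close>.\<close>
  define D where "D g = {x\<in>S. \<forall>n. g \<in> V n \<longrightarrow> g + x \<in> M n}" for g
  obtain p where p: "p \<in> ?X" "D ` S \<subseteq> p"
  proof (rule near_ultrafilter_exists)
    show "D ` S \<subseteq> Pow S" by (auto simp: D_def)
    fix \<G> assume "finite \<G>" "\<G> \<subseteq> D ` S"
    from finite_subset_image[OF this] obtain G where G: "G \<subseteq> S" "finite G" "\<G> = D ` G" by auto
    show "e \<in> closure (S \<inter> \<Inter>\<G>)"
    proof (cases "G = {}")
      case True
      then show ?thesis using G(3) near_subsemigroupD(5)[OF S] by simp
    next
      case False
      show ?thesis
        unfolding closure_iff_neighborhoods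
      proof
        fix U assume "U \<in> neighborhoods e"
        then obtain x where x: "x \<in> U \<inter> S" "\<forall>n. (\<lambda>g. g + x) ` (G \<inter> V n) \<subseteq> M n"
          using FV[rule_format, of G U] G(1,2) False unfolding M_def by auto
        then have "x \<in> D g" if "g \<in> G" for g using that unfolding D_def by auto
        then show "U \<inter> (S \<inter> \<Inter>\<G>) \<noteq> {}" using x(1) G(3) by auto
      qed
    qed
  qed
  have ideal: "semigroup_ideal (beta_plus S) ?X ?K" using S by (rule near_semigroup_ideal_smallest_ideal)
  then obtain k where k: "k \<in> ?K" "k \<in> ?X" by (auto simp: semigroup_ideal_def)
  \<comment> \<open>For \<open>s\<close> in \<open>V n \<inter> S\<close> the set
    \<open>-s + M n\<close> belongs to \<open>p\<close>, so \<open>k + p\<close> contains every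
    \<open>M n\<close> whatever \<open>k\<close> near \<open>e\<close> is used. Choosing
    \<open>k\<close> in the smallest ideal places the sum there as well.\<close>
  define r where "r = beta_plus S k p"
  have rK: "r \<in> ?K" using ideal k(1) p(1) by (simp add: semigroup_ideal_def r_def)
  have rX: "r \<in> ?X" using S k(2) p(1) unfolding r_def by (rule beta_plus_near_ultrafilters)
  have "\<exists>t\<in>F n. shift S t A \<in> r" for n
  proof -
    have "V n \<inter> S \<in> k" using V by (intro near_ultrafilters_Int_neighborhood[OF k(2)]) simp
    moreover have "V n \<inter> S \<subseteq> {s\<in>S. shift S s (M n) \<in> p}"
    proof
      fix s assume s: "s \<in> V n \<inter> S"
      then have "D s \<in> p" using p(2) by auto
      moreover have "D s \<subseteq> shift S s (M n)" using s by (auto simp: D_def shift_def)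
      ultimately have "shift S s (M n) \<in> p"
        using shift_subset by (rule beta_mono[OF near_ultrafilters_beta[OF p(1)]])
      then show "s \<in> {s\<in>S. shift S s (M n) \<in> p}" using s by simp
    qed
    ultimately have "{s\<in>S. shift S s (M n) \<in> p} \<in> k"
      by (rule beta_mono[OF near_ultrafilters_beta[OF k(2)]]) auto
    moreover have "M n \<subseteq> S" using shift_subset by (auto simp: M_def)
    ultimately have Mr: "M n \<in> r" by (simp add: r_def beta_plus_iff)
    have "finite (F n)" using F by simp
    then obtain t where "t \<in> F n" "shift S t A \<in> r"
      using Mr[unfolded M_def] by (rule beta_UN[OF near_ultrafilters_beta[OF rX] _ shift_subset])
    then show ?thesis by (rule bexI[rotated])
  qed
  then have "\<forall>n. \<exists>t. t \<in> F n \<and> shift S t A \<in> r" by auto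
  from choice[OF this] obtain t where t: "\<And>n. t n \<in> F n" "\<And>n. shift S (t n) A \<in> r" by auto
  \<comment> \<open>The points \<open>t n\<close> lie in \<open>W n\<close> and so accumulate at
    \<open>e\<close>. An ultrafilter \<open>u\<close> near \<open>e\<close> on this set gives
    \<open>A \<in> u + r\<close>, still in the smallest ideal.\<close>
  have "e \<in> closure {t\<in>S. shift S t A \<in> r}"
    unfolding closure_iff_neighborhoods
  proof
    fix U assume "U \<in> neighborhoods e"
    from decreasing_local_baseD(3)[OF W this] obtain n where "W n \<subseteq> U" ..
    moreover have "t n \<in> W n \<inter> S" using F[rule_format, of n] t(1)[of n] by auto
    ultimately have "t n \<in> U \<inter> {t\<in>S. shift S t A \<in> r}" using t(2)[of n] by auto
    then show "U \<inter> {t\<in>S. shift S t A \<in> r} \<noteq> {}" by auto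
  qed
  then obtain u where u: "u \<in> ?X" "{t\<in>S. shift S t A \<in> r} \<in> u"
    by (rule near_ultrafilter_containing[rotated]) auto
  show thesis
  proof (rule that)
    show "beta_plus S u r \<in> ?K" using ideal rK u(1) by (simp add: semigroup_ideal_def)
    show "A \<in> beta_plus S u r" using AS u(2) by (simp add: beta_plus_iff)
  qed
qed

lemma smallest_ideal_imp_piecewise_syndetic_near:
  assumes S: "near_subsemigroup e S" and W: "decreasing_local_base e W"
    and p: "p \<in> smallest_ideal (beta_plus S) (near_ultrafilters e S)" and A: "A \<in> p"
  shows "piecewise_syndetic_near e S A"
proof -
  let ?X = "near_ultrafilters e S"
  have pX: "p \<in> ?X" using near_smallest_ideal_subset[OF S] p by auto
  note pb = near_ultrafilters_beta[OF pX]
  have AS: "A \<subseteq> S" by (rule beta_subset[OF pb A])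
  \<comment> \<open>The set of \<open>s\<close> such that \<open>t + (s + x)\<close> lies in
    \<open>A\<close> for \<open>p\<close>-many \<open>x\<close>. Solving
    \<open>r + (q + p) = p\<close> shows that every \<open>q\<close> near \<open>e\<close> contains
    some \<open>B t\<close> with \<open>t\<close> in \<open>W n\<close>.\<close>
  define B where "B t = {s\<in>S. shift S s (shift S t A) \<in> p}" for t
  have cover: "\<exists>t\<in>W n \<inter> S. B t \<in> q" if q: "q \<in> ?X" for q n
  proof -
    obtain r where r: "r \<in> ?X" "beta_plus S r (beta_plus S q p) = p"
      using S p q by (rule near_smallest_ideal_left_inverse)
    note rb = near_ultrafilters_beta[OF r(1)]
    have "A \<in> beta_plus S r (beta_plus S q p)" using A r(2) by simp
    then have "{t\<in>S. shift S t A \<in> beta_plus S q p} \<in> r" by (simp add: beta_plus_iff)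
    moreover have "W n \<inter> S \<in> r"
      by (rule near_ultrafilters_Int_neighborhood[OF r(1) decreasing_local_baseD(1)[OF W]])
    ultimately have "{t\<in>S. shift S t A \<in> beta_plus S q p} \<inter> (W n \<inter> S) \<in> r"
      by (rule beta_Int[OF rb])
    then have "{t\<in>S. shift S t A \<in> beta_plus S q p} \<inter> (W n \<inter> S) \<noteq> {}"
      by (rule beta_nonempty[OF rb])
    then obtain t where "t \<in> W n \<inter> S" "shift S t A \<in> beta_plus S q p" by auto
    then show ?thesis by (auto simp: B_def beta_plus_iff)
  qed
  \<comment> \<open>A compactness argument: if no finite union of sets \<open>B t\<close> contained
    the trace of a neighborhood, their complements would generate an ultrafilter near
    \<open>e\<close> that violates \<open>cover\<close>.\<close>
  have "\<exists>F U. finite F \<and> F \<noteq> {} \<and> F \<subseteq> W n \<inter> S \<and> U \<in> neighborhoods e \<and> U \<inter> S \<subseteq> (\<Union>t\<in>F. B t)" for n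
  proof (rule ccontr)
    assume neg: "\<not> ?thesis"
    obtain q where q: "q \<in> ?X" "(\<lambda>t. S - B t) ` (W n \<inter> S) \<subseteq> q"
    proof (rule near_ultrafilter_exists)
      fix \<G> assume "finite \<G>" "\<G> \<subseteq> (\<lambda>t. S - B t) ` (W n \<inter> S)"
      from finite_subset_image[OF this] obtain F
        where F: "F \<subseteq> W n \<inter> S" "finite F" "\<G> = (\<lambda>t. S - B t) ` F" by auto
      show "e \<in> closure (S \<inter> \<Inter>\<G>)"
      proof (cases "F = {}")
        case True
        then show ?thesis using F(3) near_subsemigroupD(5)[OF S] by simp
      next
        case False
        show ?thesis
          unfolding closure_iff_neighborhoods
        proof
          fix U assume "U \<in> neighborhoods e"
          then have "\<not> U \<inter> S \<subseteq> (\<Union>t\<in>F. B t)" using neg F(1,2) False by auto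
          then show "U \<inter> (S \<inter> \<Inter>\<G>) \<noteq> {}" unfolding F(3) by auto
        qed
      qed
    qed auto
    obtain t where t: "t \<in> W n \<inter> S" "B t \<in> q" using cover[OF q(1)] by auto
    then have "S - B t \<in> q" using q(2) by auto
    moreover have "B t \<subseteq> S" by (auto simp: B_def)
    ultimately show False using t(2) by (simp add: beta_Diff_iff[OF near_ultrafilters_beta[OF q(1)]])
  qed
  then have "\<forall>n. \<exists>F. finite F \<and> F \<noteq> {} \<and> F \<subseteq> W n \<inter> S \<and> (\<exists>U. U \<in> neighborhoods e \<and> U \<inter> S \<subseteq> (\<Union>t\<in>F. B t))"
    by simp
  from choice[OF this] obtain F where FU: "\<forall>n. finite (F n) \<and> F n \<noteq> {} \<and> F n \<subseteq> W n \<inter> S \<and>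
      (\<exists>U. U \<in> neighborhoods e \<and> U \<inter> S \<subseteq> (\<Union>t\<in>F n. B t))" ..
  then have F: "finite (F n) \<and> F n \<noteq> {} \<and> F n \<subseteq> W n \<inter> S" for n by simp
  from FU have "\<forall>n. \<exists>U. U \<in> neighborhoods e \<and> U \<inter> S \<subseteq> (\<Union>t\<in>F n. B t)" by simp
  from choice[OF this] obtain U
    where U: "\<And>n. U n \<in> neighborhoods e" "\<And>n. U n \<inter> S \<subseteq> (\<Union>t\<in>F n. B t)" by auto
  define V where "V n = W n \<inter> U n" for n
  have V: "V n \<in> neighborhoods e" "V n \<subseteq> W n" for n
    using decreasing_local_baseD(1)[OF W] U(1) by (auto simp: V_def intro: neighborhoods_Int)
  define M where "M n = (\<Union>t \<in> F n. shift S t A)" for n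
  have FV: "\<exists>x \<in> N \<inter> S. \<forall>n. (\<lambda>g. g + x) ` (G \<inter> V n) \<subseteq> M n"
    if G: "finite G" "G \<subseteq> S" and N: "N \<in> neighborhoods e" for G N
  proof -
    \<comment> \<open>One \<open>x\<close> has to serve all pairs \<open>(g, n)\<close> with
      \<open>g \<in> V n\<close>. Each \<open>g\<close> differs from \<open>e\<close> and so leaves
      the decreasing sets \<open>W n\<close>; only finitely many pairs occur, and finitely many
      members of \<open>p\<close> have a common point in \<open>N\<close>.\<close>
    define P where "P = (SIGMA g:G. {n. g \<in> V n})"
    have "finite {n. g \<in> V n}" if g: "g \<in> G" for g
    proof -
      have "g \<noteq> e" using g G(2) near_subsemigroupD(4)[OF S] by auto
      then obtain n where n: "\<forall>m\<ge>n. g \<notin> W m"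
        by (rule decreasing_local_base_avoids[OF W])
      have "m < n" if "g \<in> V m" for m using n[rule_format, of m] V(2)[of m] that by (cases "n \<le> m") auto
      then have "{m. g \<in> V m} \<subseteq> {..<n}" by auto
      then show ?thesis by (rule finite_subset) simp
    qed
    then have "finite P" unfolding P_def using G(1) by (intro finite_SigmaI)
    moreover have "shift S (fst gn) (M (snd gn)) \<in> p" if gnP: "gn \<in> P" for gn
    proof -
      obtain g n where gn: "gn = (g, n)" "g \<in> G" "g \<in> V n" using gnP by (auto simp: P_def)
      then have "g \<in> U n \<inter> S" using G(2) by (auto simp: V_def)
      then obtain t where t: "t \<in> F n" "g \<in> B t" using U(2)[of n] by auto
      then have "shift S g (shift S t A) \<in> p" by (simp add: B_def)
      moreover have "shift S g (shift S t A) \<subseteq> shift S g (M n)" using t(1) by (auto simp: M_def shift_def)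
      ultimately have "shift S g (M n) \<in> p" using shift_subset by (rule beta_mono[OF pb])
      then show ?thesis by (simp add: gn(1))
    qed
    ultimately have "S \<inter> (\<Inter>gn\<in>P. shift S (fst gn) (M (snd gn))) \<in> p" by (rule beta_INT[OF pb])
    with near_ultrafilters_Int_neighborhood[OF pX N]
    have "N \<inter> S \<inter> (S \<inter> (\<Inter>gn\<in>P. shift S (fst gn) (M (snd gn)))) \<in> p" by (rule beta_Int[OF pb])
    then have "N \<inter> S \<inter> (S \<inter> (\<Inter>gn\<in>P. shift S (fst gn) (M (snd gn)))) \<noteq> {}"
      by (rule beta_nonempty[OF pb])
    then obtain x where x: "x \<in> N \<inter> S" "\<And>gn. gn \<in> P \<Longrightarrow> x \<in> shift S (fst gn) (M (snd gn))" by auto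
    have "g + x \<in> M n" if "g \<in> G \<inter> V n" for g n
      using x(2)[of "(g, n)"] that by (simp add: P_def shift_def)
    then have "\<forall>n. (\<lambda>g. g + x) ` (G \<inter> V n) \<subseteq> M n" by auto
    then show ?thesis using x(1) by (rule bexI)
  qed
  have "piecewise_syndetic_near_wrt W e S A"
    unfolding piecewise_syndetic_near_wrt_def
  proof (rule conjI[OF AS], rule exI[of _ F], rule exI[of _ V], intro conjI)
    show "\<forall>G U. finite G \<and> G \<noteq> {} \<and> G \<subseteq> S \<and> U \<in> neighborhoods e \<longrightarrow>
        (\<exists>x \<in> U \<inter> S. \<forall>n. (\<lambda>g. g + x) ` (G \<inter> V n) \<subseteq> (\<Union>t \<in> F n. shift S t A))"
      using FV[unfolded M_def] by simp
  qed (use F V in simp_all)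
  then show ?thesis using W by (auto simp: piecewise_syndetic_near_def)
qed

section \<open>Decreasing local bases at a point and at its constant tuple\<close>

lemma countable_local_base_decreasing:
  assumes "countable_local_base e"
  obtains W where "decreasing_local_base e W"
proof -
  obtain \<W> where C: "countable \<W>" "\<W> \<subseteq> neighborhoods e" "\<forall>U \<in> neighborhoods e. \<exists>W\<in>\<W>. W \<subseteq> U"
    using assms by (auto simp: countable_local_base_def)
  have ne: "\<W> \<noteq> {}" using C(3) neighborhoods_UNIV[of e] by auto
  define W where "W n = (\<Inter>k\<le>n. from_nat_into \<W> k)" for n
  have nb: "from_nat_into \<W> k \<in> neighborhoods e" for k using from_nat_into[OF ne] C(2) by auto
  have "W n \<in> neighborhoods e" for n
    by (induction n) (simp_all add: W_def atMost_Suc nb neighborhoods_Int)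
  moreover have "W (Suc n) \<subseteq> W n" for n by (auto simp: W_def)
  moreover have "\<exists>n. W n \<subseteq> U" if U: "U \<in> neighborhoods e" for U
  proof -
    obtain V where "V \<in> \<W>" "V \<subseteq> U" using C(3) U by auto
    moreover obtain n where "from_nat_into \<W> n = V" using from_nat_into_surj[OF C(1) \<open>V \<in> \<W>\<close>] by auto
    ultimately have "W n \<subseteq> U" by (auto simp: W_def)
    then show ?thesis ..
  qed
  ultimately have "decreasing_local_base e W" by (simp add: decreasing_local_base_def)
  then show thesis by (rule that)
qed

lemma decreasing_local_base_vec:
  assumes W: "decreasing_local_base e W"
  shows "decreasing_local_base (vec e :: 'a::topological_space ^ 'l::finite) (\<lambda>n. {x. \<forall>i. x $ i \<in> W n})"
  unfolding decreasing_local_base_def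
proof (intro conjI allI ballI)
  fix n
  have "open {x :: 'a ^ 'l. \<forall>i. x $ i \<in> interior (W n)}"
    by (intro open_vector_box allI open_interior)
  moreover have "e \<in> interior (W n)" using decreasing_local_baseD(1)[OF W] by (simp add: neighborhoods_def)
  ultimately have "{x :: 'a ^ 'l. \<forall>i. x $ i \<in> interior (W n)} \<in> neighborhoods (vec e)"
    by (intro open_in_neighborhoods) simp_all
  then show "{x :: 'a ^ 'l. \<forall>i. x $ i \<in> W n} \<in> neighborhoods (vec e)"
    by (rule neighborhoods_mono) (use interior_subset in auto)
  show "{x :: 'a ^ 'l. \<forall>i. x $ i \<in> W (Suc n)} \<subseteq> {x. \<forall>i. x $ i \<in> W n}"
    using decreasing_local_baseD(2)[OF W, of n "Suc n"] by auto
next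
  fix U :: "('a ^ 'l) set" assume "U \<in> neighborhoods (vec e)"
  then have "open (interior U)" "vec e \<in> interior U" by (simp_all add: neighborhoods_def)
  then have "\<exists>A. (\<forall>i. open (A i) \<and> (vec e :: 'a ^ 'l) $ i \<in> A i) \<and>
      (\<forall>y :: 'a ^ 'l. (\<forall>i. y $ i \<in> A i) \<longrightarrow> y \<in> interior U)"
    unfolding open_vec_def by (rule bspec)
  then obtain A where A: "\<forall>i. open (A i) \<and> (vec e :: 'a ^ 'l) $ i \<in> A i"
      "\<forall>y :: 'a ^ 'l. (\<forall>i. y $ i \<in> A i) \<longrightarrow> y \<in> interior U" by (elim exE conjE)
  have "\<exists>n. W n \<subseteq> A i" for i
    using A(1)[rule_format, of i] by (intro decreasing_local_baseD(3)[OF W] open_in_neighborhoods) auto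
  then obtain k where k: "\<And>i. W (k i) \<subseteq> A i" by metis
  \<comment> \<open>The index type is finite, so the levels chosen for the coordinates have a
    maximum, and a decreasing base lets that one level serve all of them.\<close>
  have kA: "W (Max (range k)) \<subseteq> A i" for i
    using decreasing_local_baseD(2)[OF W, of "k i" "Max (range k)"] k[of i] by auto
  have "{x. \<forall>i. x $ i \<in> W (Max (range k))} \<subseteq> U"
  proof
    fix x :: "'a ^ 'l" assume "x \<in> {x. \<forall>i. x $ i \<in> W (Max (range k))}"
    then have "\<forall>i. x $ i \<in> A i" using kA by auto
    then show "x \<in> U" using A(2) interior_subset by auto
  qed
  then show "\<exists>n. {x. \<forall>i. x $ i \<in> W n} \<subseteq> U" ..
qed

section \<open>Finite sums along idempotents\<close>

lemma sorted_list_of_set_Un_less: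
  fixes F G :: "nat set"
  assumes "finite F" "finite G" "\<And>a b. \<lbrakk>a \<in> F; b \<in> G\<rbrakk> \<Longrightarrow> a < b"
  shows "sorted_list_of_set (F \<union> G) = sorted_list_of_set F @ sorted_list_of_set G"
proof (rule sorted_distinct_set_unique)
  show "sorted (sorted_list_of_set F @ sorted_list_of_set G)"
    using assms by (auto simp: sorted_append intro: less_imp_le)
  show "distinct (sorted_list_of_set F @ sorted_list_of_set G)"
    using assms by fastforce
qed (use assms in auto)

text \<open>With no zero element, the fold starts from the first term. Associativity alone detaches
  a summand from the accumulator, which is what concatenation of sums requires.\<close>

lemma foldl_add_assoc:
  fixes a b :: "'a::semigroup_add"
  shows "foldl (\<lambda>s n. s + x n) (a + b) ns = a + foldl (\<lambda>s n. s + x n) b ns"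
  by (induction ns arbitrary: b) (simp_all add: add.assoc)

lemma ordered_sum_singleton [simp]: "ordered_sum x {n} = x n"
  by (simp add: ordered_sum_def Let_def)

lemma ordered_sum_Un:
  fixes x :: "nat \<Rightarrow> 'a::semigroup_add"
  assumes "finite F" "F \<noteq> {}" "finite G" "G \<noteq> {}" "\<And>a b. \<lbrakk>a \<in> F; b \<in> G\<rbrakk> \<Longrightarrow> a < b"
  shows "ordered_sum x (F \<union> G) = ordered_sum x F + ordered_sum x G"
proof -
  obtain m ms where F: "sorted_list_of_set F = m # ms"
    using assms(1,2) by (meson sorted_list_of_set_nonempty)
  obtain n ns where G: "sorted_list_of_set G = n # ns"
    using assms(3,4) by (meson sorted_list_of_set_nonempty)
  have FG: "sorted_list_of_set (F \<union> G) = (m # ms) @ n # ns"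
    unfolding F[symmetric] G[symmetric] using assms by (intro sorted_list_of_set_Un_less)
  show ?thesis by (simp add: ordered_sum_def F G FG foldl_add_assoc)
qed

text \<open>For empty or infinite \<open>F\<close> the list is empty and both sides reduce to
  \<open>h (x (hd []))\<close>, so every \<open>F\<close> is allowed.\<close>

lemma ordered_sum_hom:
  assumes "\<And>a b. h (a + b) = h a + h b"
  shows "h (ordered_sum x F) = ordered_sum (\<lambda>n. h (x n)) F"
proof -
  have "h (foldl (\<lambda>s n. s + x n) a ns) = foldl (\<lambda>s n. s + h (x n)) (h a) ns" for a ns
    by (induction ns arbitrary: a) (simp_all add: assms)
  then show ?thesis by (simp add: ordered_sum_def Let_def)
qed

lemma ordered_sum_in_FS: "\<lbrakk>finite F; F \<noteq> {}; \<And>n. n \<in> F \<Longrightarrow> m \<le> n\<rbrakk> \<Longrightarrow> ordered_sum x F \<in> FS x m"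
  by (auto simp: FS_def)

lemma FS_subset:
  assumes S: "near_subsemigroup e S" and x: "\<And>n. x n \<in> S"
  shows "FS x m \<subseteq> S"
proof -
  have "F \<noteq> {} \<longrightarrow> ordered_sum x F \<in> S" if "finite F" for F
    using that
  \<comment> \<open>Peeling off the least index matches the order of summation: it becomes the
    leftmost summand.\<close>
  proof (induction F rule: finite_linorder_min_induct)
    case (insert b A)
    show ?case
    proof (cases "A = {}")
      case False
      then have "ordered_sum x ({b} \<union> A) = x b + ordered_sum x A"
        using insert by (subst ordered_sum_Un) auto
      then show ?thesis using insert False near_subsemigroupD(2)[OF S] x by auto
    qed (use x in simp)
  qed simp
  then show ?thesis by (auto simp: FS_def)
qed

text \<open>The set of all \<open>p\<close> containing every \<open>FS x m\<close> is a closed subsemigroup, so it has an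
  idempotent by Ellis' lemma.\<close>

lemma idempotent_containing_FS:
  assumes S: "near_subsemigroup e S" and x: "\<And>n. x n \<in> S" and conv: "converges_near e x"
  obtains q where "q \<in> near_ultrafilters e S" "beta_plus S q q = q" "\<forall>m. FS x m \<in> q"
proof -
  interpret compact_right_topological_semigroup "near_ultrafilter_topology e S" "beta_plus S"
    using S by (rule compact_right_topological_semigroup_near_ultrafilters)
  have sub: "FS x m \<subseteq> S" for m using S x by (rule FS_subset)
  define Q where "Q = (\<Inter>m. {q \<in> near_ultrafilters e S. FS x m \<in> q})"
  have "closedin (near_ultrafilter_topology e S) Q"
    unfolding Q_def using sub by (intro closedin_INT closedin_near_ultrafilters_containing) auto
  moreover have "Q \<noteq> {}"
  proof -
    obtain q where q: "q \<in> near_ultrafilters e S" "range (FS x) \<subseteq> q"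
    proof (rule near_ultrafilter_exists)
      show "range (FS x) \<subseteq> Pow S" using sub by auto
      fix \<G> assume "finite \<G>" "\<G> \<subseteq> range (FS x)"
      from finite_subset_image[OF this] obtain N where N: "finite N" "\<G> = FS x ` N" by auto
      show "e \<in> closure (S \<inter> \<Inter>\<G>)"
        unfolding closure_iff_neighborhoods
      proof
        fix U assume "U \<in> neighborhoods e"
        then obtain m where m: "FS x m \<subseteq> U" using conv by (auto simp: converges_near_def)
        \<comment> \<open>A single term \<open>x k\<close> with \<open>k\<close> at least
          \<open>m\<close> and at least every index in \<open>N\<close> is a one-element sum lying
          in all sets concerned.\<close>
        define k where "k = Max (insert m N)"
        have "x k \<in> FS x n" if "n \<le> k" for n using ordered_sum_in_FS[of "{k}" n x] that by simp
        moreover have "n \<le> k" if "n \<in> insert m N" for n using that N(1) by (simp add: k_def)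
        ultimately have "x k \<in> U \<inter> (S \<inter> \<Inter>\<G>)" using m x[of k] N(2) by auto
        then show "U \<inter> (S \<inter> \<Inter>\<G>) \<noteq> {}" by auto
      qed
    qed
    then have "q \<in> Q" by (auto simp: Q_def)
    then show ?thesis by auto
  qed
  moreover have "beta_plus S p q \<in> Q" if p: "p \<in> Q" and q: "q \<in> Q" for p q
  proof -
    have pX: "p \<in> near_ultrafilters e S" and pF: "FS x m \<in> p" for m using p by (auto simp: Q_def)
    have qX: "q \<in> near_ultrafilters e S" and qF: "FS x m \<in> q" for m using q by (auto simp: Q_def)
    have "FS x m \<in> beta_plus S p q" for m
    proof -
      have "FS x m \<subseteq> {s\<in>S. shift S s (FS x m) \<in> q}"
      proof
        fix s assume s: "s \<in> FS x m"
        then obtain F where F: "s = ordered_sum x F" "finite F" "F \<noteq> {}" "\<And>n. n \<in> F \<Longrightarrow> m \<le> n"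
          by (auto simp: FS_def)
        \<comment> \<open>Sums starting beyond \<open>Max F\<close> can be appended to
          \<open>s\<close> without disturbing the order of the indices.\<close>
        have "FS x (Suc (Max F)) \<subseteq> shift S s (FS x m)"
        proof
          fix t assume t: "t \<in> FS x (Suc (Max F))"
          then obtain G where G: "t = ordered_sum x G" "finite G" "G \<noteq> {}" "\<And>n. n \<in> G \<Longrightarrow> Suc (Max F) \<le> n"
            by (auto simp: FS_def)
          have less: "a < b" if "a \<in> F" "b \<in> G" for a b
            using Max_ge[OF F(2) that(1)] G(4)[OF that(2)] by simp
          have "s + t = ordered_sum x (F \<union> G)"
            unfolding F(1) G(1) by (rule ordered_sum_Un[symmetric]) (use F G less in auto)
          moreover have "m \<le> n" if "n \<in> F \<union> G" for n
          proof -
            obtain a where "a \<in> F" using F(3) by auto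
            then show ?thesis using that F(4) less[of a n] by fastforce
          qed
          ultimately have "s + t \<in> FS x m"
            using F(2,3) G(2) ordered_sum_in_FS[of "F \<union> G" m x] by simp
          then show "t \<in> shift S s (FS x m)" using sub t by (auto simp: shift_def)
        qed
        then have "shift S s (FS x m) \<in> q"
          using shift_subset by (rule beta_mono[OF near_ultrafilters_beta[OF qX] qF])
        then show "s \<in> {s\<in>S. shift S s (FS x m) \<in> q}" using s sub by auto
      qed
      then have "{s\<in>S. shift S s (FS x m) \<in> q} \<in> p"
        by (rule beta_mono[OF near_ultrafilters_beta[OF pX] pF]) auto
      then show ?thesis using sub by (simp add: beta_plus_iff)
    qed
    then show ?thesis using beta_plus_near_ultrafilters[OF S pX qX] by (auto simp: Q_def)
  qed
  ultimately obtain q where "q \<in> Q" "beta_plus S q q = q" by (rule idempotent_exists)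
  then show thesis using that[of q] by (auto simp: Q_def)
qed

text \<open>The Galvin--Glazer argument, with the new sequence chosen as a sum subsystem of \<open>x\<close>. In
  this way it inherits convergence near \<open>e\<close> from \<open>x\<close>, for which a countable local base would
  be needed otherwise.\<close>

lemma sum_subsystem_in_idempotent_member:
  fixes x :: "nat \<Rightarrow> 'a::semigroup_add"
  assumes q: "q \<in> beta S" "beta_plus S q q = q" and FS: "\<forall>m. FS x m \<in> q" and A: "A \<in> q"
  obtains F where "\<forall>n. finite (F n) \<and> F n \<noteq> {} \<and> (\<forall>a\<in>F n. \<forall>b\<in>F (Suc n). a < b)"
    "FS (\<lambda>n. ordered_sum x (F n)) 0 \<subseteq> A"
proof -
  let ?P = "\<lambda>C F. C \<in> q \<and> C \<subseteq> A \<and> finite F \<and> F \<noteq> {} \<and> ordered_sum x F \<in> C \<and> shift S (ordered_sum x F) C \<in> q"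
  have ex: "\<exists>F. ?P C F \<and> (\<forall>n\<in>F. m \<le> n)" if C: "C \<in> q" "C \<subseteq> A" for C m
  proof -
    have "C \<in> beta_plus S q q" using C(1) q(2) by simp
    then have "{s\<in>S. shift S s C \<in> q} \<in> q" by (simp add: beta_plus_iff)
    then have "{s\<in>S. shift S s C \<in> q} \<inter> (C \<inter> FS x m) \<in> q"
      by (rule beta_Int[OF q(1) _ beta_Int[OF q(1) C(1) FS[rule_format]]])
    then have "{s\<in>S. shift S s C \<in> q} \<inter> (C \<inter> FS x m) \<noteq> {}" by (rule beta_nonempty[OF q(1)])
    then show ?thesis using C by (auto simp: FS_def)
  qed
  \<comment> \<open>The state of the recursion is a set \<open>C\<close> in \<open>q\<close> with a
    block \<open>F\<close> whose sum \<open>y\<close> lies in \<open>C\<close> and satisfies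
    \<open>-y + C \<in> q\<close>. The next set is \<open>C \<inter> (-y + C)\<close>, so adding
    \<open>y\<close> on the left leads back into \<open>C\<close>. The index \<open>n\<close> of
    \<open>P\<close> and \<open>R\<close> only fits the format of dependent choice.\<close>
  define P where "P = (\<lambda>(n::nat) (C, F). ?P C F)"
  define R where "R = (\<lambda>(n::nat) (C, F) (C', F'). C' = C \<inter> shift S (ordered_sum x F) C \<and>
     (\<forall>a\<in>F. \<forall>b\<in>F'. a < b))"
  have "\<exists>f. \<forall>n. P n (f n) \<and> R n (f n) (f (Suc n))"
  proof (rule dependent_nat_choice)
    obtain F where "?P A F" using ex[OF A order_refl, of 0] by auto
    then show "\<exists>z. P 0 z" unfolding P_def by (intro exI[of _ "(A, F)"]) simp
  next
    fix z n assume "P n z"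
    then obtain C F where z: "z = (C, F)" "?P C F" by (auto simp: P_def)
    let ?C = "C \<inter> shift S (ordered_sum x F) C"
    have "?C \<in> q" using z(2) by (intro beta_Int[OF q(1)]) simp_all
    moreover have "?C \<subseteq> A" using z(2) by auto
    ultimately obtain F' where F': "?P ?C F'" "\<forall>n\<in>F'. Suc (Max F) \<le> n" using ex by metis
    have "a < b" if ab: "a \<in> F" "b \<in> F'" for a b
    proof -
      have "a \<le> Max F" using z(2) ab(1) by simp
      also have "Max F < b" using F'(2) ab(2) by (simp add: Suc_le_eq)
      finally show ?thesis .
    qed
    then have "P (Suc n) (?C, F') \<and> R n z (?C, F')"
      using F'(1) z(1) by (simp add: P_def R_def)
    then show "\<exists>z'. P (Suc n) z' \<and> R n z z'" by (rule exI)
  qed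
  then obtain f where f: "\<And>n. P n (f n)" "\<And>n. R n (f n) (f (Suc n))" by auto
  define C where "C n = fst (f n)" for n
  define F where "F n = snd (f n)" for n
  have P: "?P (C n) (F n)" for n using f(1)[of n] by (simp add: P_def C_def F_def case_prod_beta)
  have R: "C (Suc n) = C n \<inter> shift S (ordered_sum x (F n)) (C n)" "\<forall>a\<in>F n. \<forall>b\<in>F (Suc n). a < b" for n
    using f(2)[of n] by (simp_all add: R_def C_def F_def case_prod_beta)
  have anti: "C n \<subseteq> C m" if "m \<le> n" for m n
    by (rule lift_Suc_antimono_le[OF _ that]) (simp add: R(1))
  let ?y = "\<lambda>n. ordered_sum x (F n)"
  \<comment> \<open>Splitting off the least index \<open>b\<close>: the remaining sum lies in
    \<open>C (Suc b)\<close>, hence in \<open>-y + C b\<close> for the block sum \<open>y\<close> at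
    \<open>b\<close>, and the total lies in \<open>C b\<close>.\<close>
  have "\<forall>m. (\<forall>n\<in>G. m \<le> n) \<longrightarrow> G \<noteq> {} \<longrightarrow> ordered_sum ?y G \<in> C m" if "finite G" for G
    using that
  proof (induction G rule: finite_linorder_min_induct)
    case (insert b G)
    have "ordered_sum ?y (insert b G) \<in> C b"
    proof (cases "G = {}")
      case True
      then show ?thesis using P by simp
    next
      case False
      then have "ordered_sum ?y G \<in> C (Suc b)" using insert by (simp add: Suc_le_eq)
      then have "?y b + ordered_sum ?y G \<in> C b" by (simp add: R(1) shift_def)
      moreover have "ordered_sum ?y ({b} \<union> G) = ?y b + ordered_sum ?y G"
        using insert False by (subst ordered_sum_Un) auto
      ultimately show ?thesis by simp
    qed
    then show ?case using anti by auto
  qed simp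
  then have "FS ?y 0 \<subseteq> C 0" by (auto simp: FS_def)
  also have "C 0 \<subseteq> A" using P by simp
  finally show thesis using that[of F] P R(2) by simp
qed

text \<open>A sum of block sums is the sum over the union of the blocks. The same \<open>m\<close>
  works on both sides because block \<open>n\<close> contains no index below \<open>n\<close>; this
  is what transfers convergence near \<open>e\<close>.\<close>

lemma FS_sum_subsystem:
  fixes x :: "nat \<Rightarrow> 'a::semigroup_add"
  assumes "\<forall>n. finite (F n) \<and> F n \<noteq> {} \<and> (\<forall>a\<in>F n. \<forall>b\<in>F (Suc n). a < b)"
  shows "FS (\<lambda>n. ordered_sum x (F n)) m \<subseteq> FS x m"
proof -
  have F: "finite (F n)" "F n \<noteq> {}" "\<lbrakk>a \<in> F n; b \<in> F (Suc n)\<rbrakk> \<Longrightarrow> a < b" for n a b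
    using assms by simp_all
  let ?y = "\<lambda>n. ordered_sum x (F n)"
  have less: "\<forall>a\<in>F m. \<forall>b\<in>F n. a < b" if "m < n" for m n
    using that
  proof (induction n)
    case (Suc n)
    obtain c where c: "c \<in> F n" using F(2)[of n] by auto
    show ?case
    proof (intro ballI)
      fix a b assume ab: "a \<in> F m" "b \<in> F (Suc n)"
      show "a < b"
      proof (cases "m = n")
        case False
        then have "a < c" using Suc ab(1) c by simp
        also have "c < b" using F(3) c ab(2) .
        finally show ?thesis .
      qed (use F(3) ab in simp)
    qed
  qed simp
  have ge: "n \<le> a" if "a \<in> F n" for n a
    using that
  proof (induction n arbitrary: a)
    case (Suc n)
    obtain c where c: "c \<in> F n" using F(2)[of n] by auto
    then show ?case using Suc.IH[OF c] F(3)[OF c Suc.prems] by simp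
  qed simp
  have "G \<noteq> {} \<longrightarrow> ordered_sum ?y G = ordered_sum x (\<Union>n\<in>G. F n)" if "finite G" for G
    using that
  proof (induction G rule: finite_linorder_min_induct)
    case (insert b G)
    show ?case
    proof (cases "G = {}")
      case False
      then have "ordered_sum ?y ({b} \<union> G) = ?y b + ordered_sum ?y G"
        using insert by (subst ordered_sum_Un) auto
      also have "\<dots> = ordered_sum x (F b) + ordered_sum x (\<Union>n\<in>G. F n)" using insert False by simp
      also have "\<dots> = ordered_sum x (F b \<union> (\<Union>n\<in>G. F n))"
      proof (rule ordered_sum_Un[symmetric])
        show "(\<Union>n\<in>G. F n) \<noteq> {}" using False F(2) by auto
        show "a < c" if "a \<in> F b" "c \<in> (\<Union>n\<in>G. F n)" for a c
          using that less insert by auto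
      qed (use F insert in auto)
      finally show ?thesis by simp
    qed simp
  qed simp
  moreover have "ordered_sum x (\<Union>n\<in>G. F n) \<in> FS x m"
    if "finite G" "G \<noteq> {}" "\<forall>n\<in>G. m \<le> n" for G
  proof (rule ordered_sum_in_FS)
    show "(\<Union>n\<in>G. F n) \<noteq> {}" using that F(2) by auto
    show "m \<le> a" if "a \<in> (\<Union>n\<in>G. F n)" for a
    proof -
      obtain n where "n \<in> G" "a \<in> F n" using \<open>a \<in> _\<close> by auto
      then show ?thesis using \<open>\<forall>n\<in>G. m \<le> n\<close> ge by force
    qed
  qed (use that F in auto)
  ultimately have "ordered_sum ?y G \<in> FS x m" if "finite G" "G \<noteq> {}" "\<forall>n\<in>G. m \<le> n" for G
    using that by simp
  then show ?thesis unfolding FS_def[of ?y] by blast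
qed

section \<open>Powers of a near subsemigroup\<close>

lemma pushforward_comp:
  assumes "\<And>x. x \<in> S \<Longrightarrow> f x \<in> S'"
  shows "pushforward g S' S'' (pushforward f S S' p) = pushforward (\<lambda>x. g (f x)) S S'' p"
proof -
  have "{s\<in>S. f s \<in> {t\<in>S'. g t \<in> A}} = {s\<in>S. g (f s) \<in> A}" for A using assms by auto
  then show ?thesis unfolding pushforward_def by auto
qed

lemma pushforward_ident:
  assumes "p \<in> beta S" "\<And>x. x \<in> S \<Longrightarrow> f x = x"
  shows "pushforward f S S p = p"
proof -
  have "{s\<in>S. f s \<in> A} = A" if "A \<subseteq> S" for A using that assms(2) by auto
  then show ?thesis using beta_subset[OF assms(1)] by (auto simp: pushforward_def)
qed

lemma neighborhoods_vimage_vec_nth: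
  assumes "U \<in> neighborhoods e"
  shows "(\<lambda>x :: 'a::topological_space ^ 'l::finite. x $ i) -` U \<in> neighborhoods (vec e)"
proof (rule neighborhoods_mono[OF open_in_neighborhoods])
  show "open ((\<lambda>x :: 'a ^ 'l. x $ i) -` interior U)" by (intro open_vimage_vec_nth open_interior)
  show "vec e \<in> (\<lambda>x :: 'a ^ 'l. x $ i) -` interior U" using assms by (simp add: neighborhoods_def)
qed (use interior_subset in auto)

lemma neighborhoods_vimage_vec:
  assumes "U \<in> neighborhoods (vec e :: 'a::topological_space ^ 'l::finite)"
  shows "vec -` U \<in> neighborhoods e"
proof (rule neighborhoods_mono[OF open_in_neighborhoods])
  have "continuous_on UNIV (vec :: 'a \<Rightarrow> 'a ^ 'l)"
    unfolding vec_def by (intro continuous_on_vec_lambda continuous_on_id)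
  then show "open ((vec :: 'a \<Rightarrow> 'a ^ 'l) -` interior U)" by (intro open_vimage open_interior)
  show "e \<in> (vec :: 'a \<Rightarrow> 'a ^ 'l) -` interior U" using assms by (simp add: neighborhoods_def)
qed (use interior_subset in auto)

text \<open>The setting for lifting from \<open>S\<close> to \<open>I\<close>. The closure condition
  on projections is supplied separately, as a premise of \<open>project_K_I\<close>, where
  ultrafilters are pulled back along a coordinate.\<close>

locale diagonal_near_subsemigroups =
  fixes e :: "'a::semitopological_semigroup_add" and S :: "'a set"
    and E I :: "('a ^ 'l::finite) set"
  assumes S: "near_subsemigroup e S"
    and ES: "E \<subseteq> {x. \<forall>i. x $ i \<in> S}"
    and E: "near_subsemigroup (vec e) E"
    and diagonal: "{vec a | a. a \<in> S} \<subseteq> E"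
    and ideal: "semigroup_ideal (+) E I"
    and I: "near_subsemigroup (vec e) I"
begin

section \<open>The projections, the inclusion and the diagonal as homomorphisms\<close>

lemma IE: "x \<in> I \<Longrightarrow> x \<in> E"
  using ideal by (auto simp: semigroup_ideal_def)

sublocale pi_E: near_homomorphism "vec e" E e S "\<lambda>x. x $ i" for i
  by unfold_locales (use S E ES neighborhoods_vimage_vec_nth in auto)

sublocale pi_I: near_homomorphism "vec e" I e S "\<lambda>x. x $ i" for i
  by unfold_locales (use S I IE ES neighborhoods_vimage_vec_nth in auto)

sublocale incl: near_homomorphism "vec e" I "vec e" E "\<lambda>x. x"
  by unfold_locales (use I E IE in auto)

sublocale diag: near_homomorphism e S "vec e" E vec
  by unfold_locales (use S E diagonal neighborhoods_vimage_vec in \<open>auto simp: vec_eq_iff\<close>)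

abbreviation "K_S \<equiv> smallest_ideal (beta_plus S) (near_ultrafilters e S)"
abbreviation "K_E \<equiv> smallest_ideal (beta_plus E) (near_ultrafilters (vec e) E)"
abbreviation "K_I \<equiv> smallest_ideal (beta_plus I) (near_ultrafilters (vec e) I)"

text \<open>An ultrafilter containing \<open>I\<close> is determined by its trace on
  \<open>I\<close>; intersecting its members with \<open>I\<close> keeps \<open>vec e\<close> in
  their closure.\<close>

lemma range_incl:
  assumes r: "r \<in> near_ultrafilters (vec e) E" and "I \<in> r"
  shows "r \<in> incl.push ` near_ultrafilters (vec e) I"
proof -
  obtain q where "q \<in> near_ultrafilters (vec e) I" "incl.push q = r"
  proof (rule incl.push_surj[OF r])
    fix A assume "A \<in> r"
    then have "I \<inter> A \<in> r" by (rule beta_Int[OF near_ultrafilters_beta[OF r] assms(2)])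
    then have "vec e \<in> closure (I \<inter> A)" by (rule near_ultrafilter_closure[OF r])
    also have "I \<inter> A = {s\<in>I. s \<in> A}" by auto
    finally show "vec e \<in> closure {s\<in>I. s \<in> A}" .
  qed
  then show ?thesis by auto
qed

text \<open>A subset of \<open>I\<close> is its own preimage under the inclusion, so no member is
  lost. Injectivity later brings idempotency down from \<open>E\<close> to \<open>I\<close>.\<close>

lemma inj_incl: "inj_on incl.push (near_ultrafilters (vec e) I)"
proof (rule inj_onI)
  fix p q assume p: "p \<in> near_ultrafilters (vec e) I" and q: "q \<in> near_ultrafilters (vec e) I"
    and eq: "incl.push p = incl.push q"
  show "p = q"
  proof (rule beta_eqI[OF near_ultrafilters_beta[OF p] near_ultrafilters_beta[OF q]], rule subsetI)
    fix A assume A: "A \<in> p"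
    have AI: "A \<subseteq> I" by (rule beta_subset[OF near_ultrafilters_beta[OF p] A])
    then have *: "{s\<in>I. s \<in> A} = A" by auto
    have "A \<subseteq> E" using AI IE by auto
    then have "A \<in> incl.push p" using A * by (simp add: pushforward_iff)
    then show "A \<in> q" using * by (simp add: eq pushforward_iff)
  qed
qed

text \<open>By \<open>range_incl\<close> it suffices that \<open>I\<close> belongs to the sum. On
  one side \<open>-s + I\<close> contains \<open>I\<close> for \<open>s\<close> in \<open>E\<close>;
  on the other \<open>-s + I\<close> is all of \<open>E\<close> for \<open>s\<close> in
  \<open>I\<close>.\<close>

lemma ideal_incl:
  "semigroup_ideal (beta_plus E) (near_ultrafilters (vec e) E) (incl.push ` near_ultrafilters (vec e) I)"
  unfolding semigroup_ideal_def
proof (intro conjI ballI)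
  have "near_ultrafilters (vec e) I \<noteq> {}"
    using near_semigroup_ideal_smallest_ideal[OF I] by (auto simp: semigroup_ideal_def)
  then show "incl.push ` near_ultrafilters (vec e) I \<noteq> {}" by simp
  show "incl.push ` near_ultrafilters (vec e) I \<subseteq> near_ultrafilters (vec e) E"
    using incl.push_near_ultrafilters by auto
  fix r j assume r: "r \<in> near_ultrafilters (vec e) E" and "j \<in> incl.push ` near_ultrafilters (vec e) I"
  then obtain q where q: "j = incl.push q" "q \<in> near_ultrafilters (vec e) I" by auto
  have j: "j \<in> near_ultrafilters (vec e) E" using q incl.push_near_ultrafilters by simp
  have IE': "I \<subseteq> E" using IE by auto
  have Ij: "I \<in> j" using beta_space[OF near_ultrafilters_beta[OF q(2)]] IE' by (simp add: q(1) pushforward_iff)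
  have "shift E s I \<in> j" if "s \<in> E" for s
  proof -
    have "I \<subseteq> shift E s I" using that ideal IE by (auto simp: semigroup_ideal_def shift_def)
    then show ?thesis using shift_subset by (rule beta_mono[OF near_ultrafilters_beta[OF j] Ij])
  qed
  then have "{s\<in>E. shift E s I \<in> j} = E" by auto
  then have "I \<in> beta_plus E r j"
    using IE' beta_space[OF near_ultrafilters_beta[OF r]] by (simp add: beta_plus_iff)
  then show "beta_plus E r j \<in> incl.push ` near_ultrafilters (vec e) I"
    by (rule range_incl[OF beta_plus_near_ultrafilters[OF E r j]])
  have "shift E s I \<in> r" if "s \<in> I" for s
  proof -
    have "shift E s I = E" using that ideal by (auto simp: semigroup_ideal_def shift_def)
    then show ?thesis using beta_space[OF near_ultrafilters_beta[OF r]] by simp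
  qed
  then have "I \<subseteq> {s\<in>E. shift E s I \<in> r}" using IE by auto
  then have "{s\<in>E. shift E s I \<in> r} \<in> j"
    by (rule beta_mono[OF near_ultrafilters_beta[OF j] Ij]) auto
  then have "I \<in> beta_plus E j r" using IE' by (simp add: beta_plus_iff)
  then show "beta_plus E j r \<in> incl.push ` near_ultrafilters (vec e) I"
    by (rule range_incl[OF beta_plus_near_ultrafilters[OF E j r]])
qed

lemma lift_K_E:
  assumes "r \<in> K_E"
  obtains q where "q \<in> K_I" "incl.push q = r"
proof (rule smallest_ideal_preimage[OF assms inj_incl ideal_incl])
  show "incl.push (beta_plus I a b) = beta_plus E (incl.push a) (incl.push b)" for a b
    by (rule incl.push_plus)
  show "beta_plus E (beta_plus E a b) c = beta_plus E a (beta_plus E b c)" for a b c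
    using near_subsemigroupD(2)[OF E] by (rule beta_plus_assoc)
  show "beta_plus I a b \<in> near_ultrafilters (vec e) I"
    if "a \<in> near_ultrafilters (vec e) I" "b \<in> near_ultrafilters (vec e) I" for a b
    using I that by (rule beta_plus_near_ultrafilters)
qed (rule that)

lemma pi_incl: "pi_E.push i (incl.push q) = pi_I.push i q"
  by (rule pushforward_comp) (rule IE)

lemma pi_diag:
  assumes "p \<in> near_ultrafilters e S"
  shows "pi_E.push i (diag.push p) = p"
proof -
  have "pi_E.push i (diag.push p) = pushforward (\<lambda>x. vec x $ i) S S p"
    by (rule pushforward_comp) (rule diag.maps)
  also have "\<dots> = p" by (rule pushforward_ident[OF near_ultrafilters_beta[OF assms]]) simp
  finally show ?thesis .
qed

text \<open>A minimal idempotent below the diagonal copy of \<open>p\<close> projects to an idempotent below \<open>p\<close>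
  in every coordinate, hence to \<open>p\<close> itself when \<open>p\<close> is minimal.\<close>

lemma idempotent_over_diagonal:
  assumes p: "p \<in> K_S" "beta_plus S p p = p"
  obtains r where "r \<in> K_E" "beta_plus E r r = r" "\<And>i. pi_E.push i r = p"
proof -
  have pX: "p \<in> near_ultrafilters e S" using near_smallest_ideal_subset[OF S] p(1) by auto
  have "beta_plus E (diag.push p) (diag.push p) = diag.push p"
    using diag.push_plus[of p p] p(2) by simp
  then obtain r where r: "r \<in> K_E" "beta_plus E r r = r"
      "beta_plus E (diag.push p) r = r" "beta_plus E r (diag.push p) = r"
    by (rule near_smallest_ideal_idempotent_below[OF E diag.push_near_ultrafilters[OF pX]])
  have rX: "r \<in> near_ultrafilters (vec e) E" using near_smallest_ideal_subset[OF E] r(1) by auto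
  have "pi_E.push i r = p" for i
  proof (rule near_smallest_ideal_idempotent_minimal[OF S p(1) pi_E.push_near_ultrafilters[OF rX]])
    show "beta_plus S (pi_E.push i r) (pi_E.push i r) = pi_E.push i r"
      using pi_E.push_plus[of i r r] r(2) by simp
    show "beta_plus S p (pi_E.push i r) = pi_E.push i r"
      using pi_E.push_plus[of i "diag.push p" r] r(3) pi_diag[OF pX] by simp
    show "beta_plus S (pi_E.push i r) p = pi_E.push i r"
      using pi_E.push_plus[of i r "diag.push p"] r(4) pi_diag[OF pX] by simp
  qed
  then show thesis using r(1,2) that by simp
qed

lemma lift_K_S_idempotent:
  assumes "p \<in> K_S" "beta_plus S p p = p"
  obtains q where "q \<in> K_I" "beta_plus I q q = q" "\<And>i. pi_I.push i q = p"
proof -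
  obtain r where r: "r \<in> K_E" "beta_plus E r r = r" "\<And>i. pi_E.push i r = p"
    by (rule idempotent_over_diagonal[OF assms]) simp
  obtain q where q: "q \<in> K_I" "incl.push q = r" using r(1) by (rule lift_K_E)
  have qX: "q \<in> near_ultrafilters (vec e) I" using near_smallest_ideal_subset[OF I] q(1) by auto
  have "incl.push (beta_plus I q q) = incl.push q" using incl.push_plus[of q q] q(2) r(2) by simp
  then have "beta_plus I q q = q"
    by (rule inj_onD[OF inj_incl]) (use beta_plus_near_ultrafilters[OF I qX qX] qX in auto)
  moreover have "pi_I.push i q = p" for i using pi_incl[of i q] q(2) r(3) by simp
  ultimately show thesis using q(1) that by simp
qed

text \<open>A general \<open>p\<close> need not be idempotent, but \<open>p = p + u\<close> for an
  idempotent \<open>u\<close> of the smallest ideal. Lifting \<open>u\<close> to \<open>r\<close>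
  and adding the diagonal image of \<open>p\<close> on the left gives an element whose projections
  are \<open>p + u = p\<close>.\<close>

lemma lift_K_S:
  assumes "p \<in> K_S"
  obtains q where "q \<in> K_I" "\<And>i. pi_I.push i q = p"
proof -
  have pX: "p \<in> near_ultrafilters e S" using near_smallest_ideal_subset[OF S] assms by auto
  obtain u where u: "u \<in> K_S" "beta_plus S u u = u" "beta_plus S p u = p"
    by (rule near_smallest_ideal_right_identity[OF S assms])
  obtain r where r: "r \<in> K_E" "\<And>i. pi_E.push i r = u"
    by (rule idempotent_over_diagonal[OF u(1,2)]) simp
  have "beta_plus E (diag.push p) r \<in> K_E"
    using near_semigroup_ideal_smallest_ideal[OF E] r(1) diag.push_near_ultrafilters[OF pX]
    by (simp add: semigroup_ideal_def)
  then obtain q where q: "q \<in> K_I" "incl.push q = beta_plus E (diag.push p) r" by (rule lift_K_E)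
  have "pi_I.push i q = p" for i
    using pi_incl[of i q] pi_E.push_plus[of i "diag.push p" r] q(2) r(2) pi_diag[OF pX] u(3) by simp
  then show thesis using q(1) that by simp
qed

text \<open>The box is the intersection of finitely many coordinate preimages, so all questions
  about it reduce to single projections.\<close>

lemma box_mem_iff:
  assumes q: "q \<in> near_ultrafilters (vec e) I" and "B \<subseteq> S"
  shows "{x. \<forall>i. x $ i \<in> B} \<inter> I \<in> q \<longleftrightarrow> (\<forall>i. B \<in> pi_I.push i q)"
proof
  note qb = near_ultrafilters_beta[OF q]
  assume box: "{x. \<forall>i. x $ i \<in> B} \<inter> I \<in> q"
  have "{x\<in>I. x $ i \<in> B} \<in> q" for i by (rule beta_mono[OF qb box]) auto
  then show "\<forall>i. B \<in> pi_I.push i q" using assms(2) by (simp add: pushforward_iff)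
next
  note qb = near_ultrafilters_beta[OF q]
  assume "\<forall>i. B \<in> pi_I.push i q"
  then have "I \<inter> (\<Inter>i\<in>UNIV. {x\<in>I. x $ i \<in> B}) \<in> q"
    by (intro beta_INT[OF qb]) (simp_all add: pushforward_iff)
  also have "I \<inter> (\<Inter>i\<in>UNIV. {x\<in>I. x $ i \<in> B}) = {x. \<forall>i. x $ i \<in> B} \<inter> I" by auto
  finally show "{x. \<forall>i. x $ i \<in> B} \<inter> I \<in> q" .
qed

lemma project_K_I:
  assumes cl: "\<And>\<E>. \<lbrakk>\<E> \<subseteq> (\<lambda>x. x $ i) ` I; e \<in> closure \<E>\<rbrakk> \<Longrightarrow> vec e \<in> closure {x \<in> I. x $ i \<in> \<E>}"
    and q: "q \<in> K_I"
  shows "pi_I.push i q \<in> K_S"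
proof (rule smallest_ideal_image[OF q])
  show "q \<in> near_ultrafilters (vec e) I" using near_smallest_ideal_subset[OF I] q by auto
  show "pi_I.push i (beta_plus I a b) = beta_plus S (pi_I.push i a) (pi_I.push i b)" for a b
    by (rule pi_I.push_plus)
  show "beta_plus I a b \<in> near_ultrafilters (vec e) I"
    if "a \<in> near_ultrafilters (vec e) I" "b \<in> near_ultrafilters (vec e) I" for a b
    using I that by (rule beta_plus_near_ultrafilters)
  show "pi_I.push i ` near_ultrafilters (vec e) I \<subseteq> near_ultrafilters e S"
    using pi_I.push_near_ultrafilters by auto
  fix a b assume a: "a \<in> near_ultrafilters (vec e) I" and b: "b \<in> near_ultrafilters e S"
  let ?I = "(\<lambda>x. x $ i) ` I"
  define r where "r = beta_plus S (pi_I.push i a) b"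
  have r: "r \<in> near_ultrafilters e S"
    unfolding r_def using S pi_I.push_near_ultrafilters[OF a] b by (rule beta_plus_near_ultrafilters)
  have IS: "?I \<subseteq> S" using pi_I.maps by auto
  \<comment> \<open>The projection of \<open>I\<close> absorbs \<open>S\<close> on the right,
    because adding a constant tuple keeps a point inside the ideal \<open>I\<close>. Hence
    \<open>?I\<close> belongs to \<open>r\<close> for every \<open>b\<close>, and the closure
    premise can be applied to the traces on \<open>?I\<close> of members of
    \<open>r\<close>.\<close>
  have "shift S s ?I \<in> b" if s: "s \<in> ?I" for s
  proof -
    obtain x where x: "x \<in> I" "s = x $ i" using s by auto
    have "s + t \<in> ?I" if "t \<in> S" for t
    proof (rule image_eqI)
      show "s + t = (x + vec t) $ i" by (simp add: x(2))
      have "vec t \<in> E" using diagonal that by auto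
      then show "x + vec t \<in> I" using ideal x(1) by (simp add: semigroup_ideal_def)
    qed
    then have "shift S s ?I = S" by (auto simp: shift_def)
    then show ?thesis using beta_space[OF near_ultrafilters_beta[OF b]] by simp
  qed
  then have "{x\<in>I. x $ i \<in> {s\<in>S. shift S s ?I \<in> b}} = I" using IS by auto
  then have "?I \<in> r"
    unfolding r_def using IS beta_space[OF near_ultrafilters_beta[OF a]]
    by (simp add: beta_plus_iff pushforward_iff)
  obtain p where "p \<in> near_ultrafilters (vec e) I" "pi_I.push i p = r"
  proof (rule pi_I.push_surj[OF r])
    fix A assume "A \<in> r"
    then have "?I \<inter> A \<in> r" by (rule beta_Int[OF near_ultrafilters_beta[OF r] \<open>?I \<in> r\<close>])
    then have "e \<in> closure (?I \<inter> A)" by (rule near_ultrafilter_closure[OF r])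
    then have "vec e \<in> closure {x\<in>I. x $ i \<in> ?I \<inter> A}" by (intro cl) auto
    also have "{x\<in>I. x $ i \<in> ?I \<inter> A} = {x\<in>I. x $ i \<in> A}" by auto
    finally show "vec e \<in> closure {x\<in>I. x $ i \<in> A}" .
  qed
  then show "beta_plus S (pi_I.push i a) b \<in> pi_I.push i ` near_ultrafilters (vec e) I"
    unfolding r_def by (intro image_eqI[of _ _ p]) simp_all
qed

text \<open>One idempotent \<open>q\<close> containing all tails of sums handles the coordinates
  together: each coordinate preimage of \<open>B\<close> is shown to belong to \<open>q\<close>, and
  \<open>q\<close> is closed under their intersection.\<close>

lemma IP_star_box:
  assumes BS: "B \<subseteq> S" and B: "IP_star_near e S B"
  shows "IP_star_near (vec e) I ({x. \<forall>i. x $ i \<in> B} \<inter> I)"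
  unfolding IP_star_near_def star_family_def
proof (intro conjI allI impI)
  fix C assume C: "IP_near (vec e) I C"
  then obtain x where CI: "C \<subseteq> I" and x: "\<And>n. x n \<in> I" "converges_near (vec e) x" "FS x 0 \<subseteq> C"
    by (auto simp: IP_near_def)
  obtain q where q: "q \<in> near_ultrafilters (vec e) I" "beta_plus I q q = q" and FSq: "\<forall>m. FS x m \<in> q"
    by (rule idempotent_containing_FS[OF I x(1,2)])
  note qb = near_ultrafilters_beta[OF q(1)]
  have "{z\<in>I. z $ i \<in> B} \<in> q" for i
  proof (rule ccontr)
    assume "{z\<in>I. z $ i \<in> B} \<notin> q"
    then have "I - {z\<in>I. z $ i \<in> B} \<in> q" using beta_Diff_iff[OF qb, of "{z\<in>I. z $ i \<in> B}"] by simp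
    then obtain F where F: "\<forall>n. finite (F n) \<and> F n \<noteq> {} \<and> (\<forall>a\<in>F n. \<forall>b\<in>F (Suc n). a < b)"
      and FSF: "FS (\<lambda>n. ordered_sum x (F n)) 0 \<subseteq> I - {z\<in>I. z $ i \<in> B}"
      by (rule sum_subsystem_in_idempotent_member[OF qb q(2) FSq])
    \<comment> \<open>Projecting the sum subsystem turns its sums into sums of \<open>w\<close>,
      since the coordinate map is additive. Convergence near \<open>e\<close> passes from
      \<open>x\<close> to \<open>w\<close> through the preimage of a neighborhood.\<close>
    define w where "w n = ordered_sum x (F n) $ i" for n
    have FSw: "FS w m = (\<lambda>z. z $ i) ` FS (\<lambda>n. ordered_sum x (F n)) m" for m
    proof -
      have "ordered_sum w G = ordered_sum (\<lambda>n. ordered_sum x (F n)) G $ i" for G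
        unfolding w_def by (rule ordered_sum_hom[symmetric]) simp
      then show ?thesis by (auto simp: FS_def)
    qed
    have FSw0: "FS w 0 \<subseteq> S - B" unfolding FSw using FSF pi_I.maps by auto
    have "IP_near e S (S - B)"
      unfolding IP_near_def
    proof (intro conjI exI allI)
      show "w n \<in> S" for n using ordered_sum_in_FS[of "{n}" 0 w] FSw0 by auto
      show "converges_near e w"
        unfolding converges_near_def
      proof
        fix U assume "U \<in> neighborhoods e"
        then have "(\<lambda>z :: 'a ^ 'l. z $ i) -` U \<in> neighborhoods (vec e)"
          by (rule neighborhoods_vimage_vec_nth)
        then obtain m where "FS x m \<subseteq> (\<lambda>z. z $ i) -` U" using x(2) by (auto simp: converges_near_def)
        moreover have "FS (\<lambda>n. ordered_sum x (F n)) m \<subseteq> FS x m" using F by (rule FS_sum_subsystem)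
        ultimately have "FS w m \<subseteq> U" unfolding FSw by auto
        then show "\<exists>m. FS w m \<subseteq> U" ..
      qed
      show "FS w 0 \<subseteq> S - B" by (rule FSw0)
    qed auto
    moreover have "\<forall>C. IP_near e S C \<longrightarrow> B \<inter> C \<noteq> {}"
      using B unfolding IP_star_near_def star_family_def by (rule conjunct2)
    ultimately have "B \<inter> (S - B) \<noteq> {}" by (elim allE impE)
    then show False by auto
  qed
  then have "{x. \<forall>i. x $ i \<in> B} \<inter> I \<in> q" using BS by (simp add: box_mem_iff[OF q(1)] pushforward_iff)
  moreover have "C \<in> q" by (rule beta_mono[OF qb FSq[rule_format] x(3) CI])
  ultimately have "{x. \<forall>i. x $ i \<in> B} \<inter> I \<inter> C \<in> q" by (rule beta_Int[OF qb])
  then show "{x. \<forall>i. x $ i \<in> B} \<inter> I \<inter> C \<noteq> {}" by (rule beta_nonempty[OF qb])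
qed auto

end

theorem theorem3p12:
  fixes e :: "'a::semitopological_semigroup_add"
    and S B :: "'a set"
    and E I :: "('a ^ 'l::finite) set"
  assumes "near_subsemigroup e S"
    and "E \<subseteq> {x. \<forall>i. x $ i \<in> S}"
    and "near_subsemigroup (vec e) E"
    and "{vec a | a. a \<in> S} \<subseteq> E"
    and "semigroup_ideal (+) E I"
    and "near_subsemigroup (vec e) I"
    and "\<forall>i. \<forall>\<E> \<subseteq> (\<lambda>x. x $ i) ` I.
           e \<in> closure \<E> \<longrightarrow> vec e \<in> closure {x \<in> I. x $ i \<in> \<E>}"
    and "B \<subseteq> S"
  shows "(central_near e S B \<longrightarrow>
            central_near (vec e) I ({x. \<forall>i. x $ i \<in> B} \<inter> I))
       \<and> (countable_local_base e \<and> piecewise_syndetic_near e S B \<longrightarrow>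
            piecewise_syndetic_near (vec e) I ({x. \<forall>i. x $ i \<in> B} \<inter> I))
       \<and> (countable_local_base e \<and> central_star_near e S B \<longrightarrow>
            central_star_near (vec e) I ({x. \<forall>i. x $ i \<in> B} \<inter> I))
       \<and> (countable_local_base e \<and> PS_star_near e S B \<longrightarrow>
            PS_star_near (vec e) I ({x. \<forall>i. x $ i \<in> B} \<inter> I))
       \<and> (IP_star_near e S B \<longrightarrow>
            IP_star_near (vec e) I ({x. \<forall>i. x $ i \<in> B} \<inter> I))"
proof -
  note BS = assms(8)
  interpret diagonal_near_subsemigroups e S E I by unfold_locales (rule assms)+
  let ?B = "{x. \<forall>i. x $ i \<in> B} \<inter> I"
  have K_IX: "q \<in> near_ultrafilters (vec e) I" if "q \<in> K_I" for q
    using near_smallest_ideal_subset[OF I] that by auto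
  have K_SX: "p \<in> near_ultrafilters e S" if "p \<in> K_S" for p
    using near_smallest_ideal_subset[OF S] that by auto
  have down: "pi_I.push i q \<in> K_S" if "q \<in> K_I" for i q
    by (rule project_K_I[OF _ that]) (use assms(7) in simp)
  have meet: "?B \<inter> C \<noteq> {}" if q: "q \<in> K_I" and C: "C \<in> q" and B: "\<And>i. B \<in> pi_I.push i q" for q C
  proof -
    have "?B \<in> q" using B by (simp add: box_mem_iff[OF K_IX[OF q] BS])
    then have "?B \<inter> C \<in> q" using C by (rule beta_Int[OF near_ultrafilters_beta[OF K_IX[OF q]]])
    then show ?thesis by (rule beta_nonempty[OF near_ultrafilters_beta[OF K_IX[OF q]]])
  qed
  \<comment> \<open>This is the passage from a star property to ultrafilters: if \<open>p\<close>
    missed \<open>B\<close>, then \<open>S - B\<close> would be a member of \<open>p\<close>, hence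
    a set of the class \<open>P\<close>, yet disjoint from \<open>B\<close>.\<close>
  have star: "B \<in> p" if "p \<in> K_S" "star_family P S B" "S - B \<in> p \<Longrightarrow> P (S - B)" for p P
  proof (rule ccontr)
    assume "B \<notin> p"
    then have "P (S - B)" using that(3) beta_Diff_iff[OF near_ultrafilters_beta[OF K_SX[OF that(1)]] BS] by simp
    moreover have "\<forall>C. P C \<longrightarrow> B \<inter> C \<noteq> {}" using that(2) unfolding star_family_def by (rule conjunct2)
    ultimately have "B \<inter> (S - B) \<noteq> {}" by (elim allE impE)
    then show False by auto
  qed
  have central: "central_near (vec e) I ?B" if B: "central_near e S B"
  proof -
    obtain p where p: "p \<in> K_S" "beta_plus S p p = p" "B \<in> p" using B by (auto simp: central_near_def)
    obtain q where q: "q \<in> K_I" "beta_plus I q q = q" "\<And>i. pi_I.push i q = p"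
      by (rule lift_K_S_idempotent[OF p(1,2)]) simp
    have "?B \<in> q" using p(3) q(3) by (simp add: box_mem_iff[OF K_IX[OF q(1)] BS])
    then show ?thesis unfolding central_near_def using q(1,2) by auto
  qed
  have ps: "piecewise_syndetic_near (vec e) I ?B"
    if base: "countable_local_base e" and B: "piecewise_syndetic_near e S B"
  proof -
    obtain W where W: "decreasing_local_base e W" using base by (rule countable_local_base_decreasing)
    obtain p where p: "p \<in> K_S" "B \<in> p" by (rule piecewise_syndetic_near_imp_smallest_ideal[OF S B])
    obtain q where q: "q \<in> K_I" "\<And>i. pi_I.push i q = p" by (rule lift_K_S[OF p(1)]) simp
    have "?B \<in> q" using p(2) q(2) by (simp add: box_mem_iff[OF K_IX[OF q(1)] BS])
    then show ?thesis
      by (rule smallest_ideal_imp_piecewise_syndetic_near[OF I decreasing_local_base_vec[OF W] q(1)])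
  qed
  have central_star: "central_star_near (vec e) I ?B" if B: "central_star_near e S B"
    unfolding central_star_near_def star_family_def
  proof (intro conjI allI impI)
    fix C assume "central_near (vec e) I C"
    then obtain q where q: "q \<in> K_I" "beta_plus I q q = q" "C \<in> q" by (auto simp: central_near_def)
    have "B \<in> pi_I.push i q" for i
    proof (rule star[OF down[OF q(1)] B[unfolded central_star_near_def]])
      assume "S - B \<in> pi_I.push i q"
      moreover have "beta_plus S (pi_I.push i q) (pi_I.push i q) = pi_I.push i q"
        using pi_I.push_plus[of i q q] q(2) by simp
      ultimately show "central_near e S (S - B)"
        unfolding central_near_def using down[OF q(1)] by auto
    qed
    then show "?B \<inter> C \<noteq> {}" by (rule meet[OF q(1,3)])
  qed auto
  have PS_star: "PS_star_near (vec e) I ?B"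
    if base: "countable_local_base e" and B: "PS_star_near e S B"
    unfolding PS_star_near_def star_family_def
  proof (intro conjI allI impI)
    obtain W where W: "decreasing_local_base e W" using base by (rule countable_local_base_decreasing)
    fix C assume "piecewise_syndetic_near (vec e) I C"
    then obtain q where q: "q \<in> K_I" "C \<in> q" by (rule piecewise_syndetic_near_imp_smallest_ideal[OF I])
    have "B \<in> pi_I.push i q" for i
      by (rule star[OF down[OF q(1)] B[unfolded PS_star_near_def]])
         (rule smallest_ideal_imp_piecewise_syndetic_near[OF S W down[OF q(1)]])
    then show "?B \<inter> C \<noteq> {}" by (rule meet[OF q])
  qed auto
  show ?thesis using central ps central_star PS_star IP_star_box[OF BS] by blast
qed

end
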